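(* Suppose $A\in S_3$. The numerical range $W(A)$ is an elliptical disk if and only if there exist $a,b\in\mathbb{D}$ such that $$\det(zI-A)=\Phi_1(z;a)\,\Phi_2(z;a,b).$$ If this condition holds, then the pentagram curve of $A$ is the single point $\bar a$, and the foci of $\partial W(A)$ are the zeros of $\Phi_2(z;a,b)$.
   Context: $\mathbb{D}$ is the open unit disk and $\mathbb{T}$ the unit circle in $\mathbb{C}$. $S_n$ is the set of complex $n\times n$ matrices $A$ with $\|A\|=1$, all eigenvalues in $\mathbb{D}$, and $\operatorname{rank}(I-AA^* )=\operatorname{rank}(I-A^*A)=1$. The numerical range is $W(A)=\{\langle x,Ax\rangle:\ x\in\mathbb{C}^n,\ \|x\|=1\}$; it is an elliptical disk if it is bounded by an ellipse. For $\Phi_m(z)=\sum_{i=0}^m c_iz^i$ of degree $m$, put $\Phi_m^*(z)=\sum_{i=0}^m\overline{c_i}z^{m-i}$. For $\alpha_0,\alpha_1,\ldots\in\mathbb{D}$ the monic polynomials $\Phi_m(z;\alpha_0,\ldots,\alpha_{m-1})$ are defined by $\Phi_0=1$ and the Szegő recursion $\Phi_{m+1}(z;\alpha_0,\ldots,\alpha_m)=z\Phi_m(z)-\overline{\alpha_m}\,\Phi_m^*(z)$, where $\Phi_m(z)=\Phi_m(z;\alpha_0,\ldots,\alpha_{m-1})$. In particular $\Phi_1(z;a)=z-\bar a$. Pentagram curve: for $A\in S_n$ with $\Phi_n(z)=\det(zI-A)$ and $\lambda\in\mathbb{T}$, the polynomial $z\Phi_n(z)-\bar\lambda\Phi_n^*(z)$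 has $n+1$ distinct zeros, all on $\mathbb{T}$; label them in cyclic order $P_1,\ldots,P_{n+1}$ (indices mod $n+1$). (As $\lambda$ varies, the convex polygons $P_1\cdots P_{n+1}$ are exactly the $(n+1)$-gons inscribed in $\mathbb{T}$ and circumscribed about $W(A)$.) The pentagram curve of $A$ is the envelope of all lines $P_jP_{j+2}$, over all $\lambda\in\mathbb{T}$ and all $j$. It is a single point $p$ when all these lines pass through $p$. *)

theory Defs
  imports "HOL-Analysis.Analysis" "HOL-Computational_Algebra.Polynomial"
begin

definition cadjoint :: "complex^'n^'n \<Rightarrow> complex^'n^'n" where
  "cadjoint A = (\<chi> i j. cnj (A $ j $ i))"

definition charpoly :: "'a::comm_ring_1^'n^'n \<Rightarrow> 'a poly" where
  "charpoly A = det (\<chi> i j. (if i = j then [:0, 1:] else 0) - [:A $ i $ j:])"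

(* The norm on complex^'n is the Euclidean one, so onorm is the l2 operator norm. *)
definition S_class :: "(complex^'n^'n) set" where
  "S_class = {A. onorm (\<lambda>x. A *v x) = 1 \<and>
     (\<forall>c x. x \<noteq> 0 \<and> A *v x = c *s x \<longrightarrow> cmod c < 1) \<and>
     rank (mat 1 - A ** cadjoint A) = 1 \<and>
     rank (mat 1 - cadjoint A ** A) = 1}"

definition numerical_range :: "complex^'n^'n \<Rightarrow> complex set" where
  "numerical_range A = {(\<Sum>i\<in>UNIV. cnj (x $ i) * (A *v x) $ i) | x. norm x = 1}"

(* s is the length of the major axis; dist f g < s excludes the degenerate case of a
   segment, while f = g gives a circle. *)
definition ellipse_with_foci :: "complex set \<Rightarrow> complex \<Rightarrow> complex \<Rightarrow> bool" where
  "ellipse_with_foci E f g \<longleftrightarrow> (\<exists>s. dist f g < s \<and> E = {z. dist z f + dist z g = s})"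

definition elliptical_disk :: "complex set \<Rightarrow> bool" where
  "elliptical_disk W \<longleftrightarrow> (\<exists>f g. ellipse_with_foci (frontier W) f g)"

(* For p of exact degree m this is z^m * cnj (p (1 / cnj z)). *)
definition rev_poly :: "complex poly \<Rightarrow> complex poly" where
  "rev_poly p = reflect_poly (map_poly cnj p)"

definition szego_step :: "complex poly \<Rightarrow> complex \<Rightarrow> complex poly" where
  "szego_step p \<alpha> = [:0, 1:] * p - smult (cnj \<alpha>) (rev_poly p)"

(* szego_poly [a0, ..., a(m-1)] is Phi_m(z; a0, ..., a(m-1)). *)
definition szego_poly :: "complex list \<Rightarrow> complex poly" where
  "szego_poly as = foldl szego_step 1 as"

definition cyclic_labelling :: "nat \<Rightarrow> (nat \<Rightarrow> complex) \<Rightarrow> complex set \<Rightarrow> bool" where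
  "cyclic_labelling m P Z \<longleftrightarrow> Z = P ` {..<m} \<and>
     (\<exists>\<theta>. strict_mono_on {..<m} \<theta> \<and> (\<forall>j<m. P j = cis (\<theta> j) \<and> \<theta> j < \<theta> 0 + 2 * pi))"

(* Endpoints of the chords joining P_j and P_(j+2); labels are 0, ..., n instead of 1, ..., n+1. *)
definition pentagram_chords :: "complex^'n^'n \<Rightarrow> (complex \<times> complex) set" where
  "pentagram_chords A = {(P j, P ((j + 2) mod (CARD('n) + 1))) | P j l.
     cmod l = 1 \<and> j < CARD('n) + 1 \<and>
     cyclic_labelling (CARD('n) + 1) P {z. poly (szego_step (charpoly A) l) z = 0}}"

definition chord_line :: "complex \<times> complex \<Rightarrow> complex set" where
  "chord_line c = affine hull {fst c, snd c}"

(* The envelope of a family of lines: on each line of the family, the limits of its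
   intersection points with other lines of the family that converge to it. *)
definition envelope :: "(complex \<times> complex) set \<Rightarrow> complex set" where
  "envelope C = {p. \<exists>c\<in>C. \<exists>X q.
     (\<forall>k::nat. X k \<in> C \<and> chord_line (X k) \<noteq> chord_line c \<and>
        q k \<in> chord_line (X k) \<inter> chord_line c) \<and>
     X \<longlonglongrightarrow> c \<and> q \<longlonglongrightarrow> p}"

definition pentagram_curve :: "complex^'n^'n \<Rightarrow> complex set" where
  "pentagram_curve A = envelope (pentagram_chords A)"

end

theory Submission
  imports Defs
begin

text \<open>
  The numerical range \<open>W(A)\<close> is convex (Toeplitz--Hausdorff) and compact, so it is determined by its
  tangents. For a unit vector \<open>u\<close> the largest \<open>t\<close> for which the line \<open>2 Re (cnj u * z) = t\<close> meets
  \<open>W(A)\<close> is the largest eigenvalue of \<open>cnj u A + u A*\<close>, hence a root of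
  \<open>det (t - cnj u A - u A*)\<close>. When \<open>I - A A*\<close> has rank one, this determinant is a cubic in \<open>t\<close> whose
  coefficients depend only on the characteristic polynomial \<open>z^3 - \<tau> z^2 + \<sigma> z - \<delta>\<close>
  (\<open>det_rotated_sum\<close>): rank one forces \<open>tr (A A*) = 2 + |\<delta>|^2\<close> and a similar identity for the trace of
  \<open>adj A A*\<close>.

  The tangents of an ellipse with foci \<open>f\<close>, \<open>g\<close> and major axis \<open>s\<close> in direction \<open>u\<close> are the roots of the
  quadratic \<open>(t - 2 Re (cnj u f)) (t - 2 Re (cnj u g)) - (s^2 - |f - g|^2)\<close>. So the question is when
  this quadratic divides the cubic for every \<open>u\<close>. The quotient is then \<open>t - 2 Re (cnj u c)\<close> with \<open>c\<close>
  the third eigenvalue of \<open>A\<close>, and comparing coefficients of the trigonometric polynomials in \<open>u\<close>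
  leaves one condition (\<open>kippenhahn_factor\<close>, \<open>focal_relation\<close>):
  \<open>c (1 - |fg|^2) = (f + g) - fg cnj (f + g)\<close>. With \<open>c = cnj a\<close> and \<open>fg = - cnj b\<close> and \<open>|b| < 1\<close> it says
  exactly that \<open>f\<close>, \<open>g\<close> are the zeros of \<open>\<Phi>_2(z; a, b) = z^2 - (cnj a - a cnj b) z - cnj b\<close>.

  If \<open>W(A)\<close> is elliptical, its upper tangents give one common root of cubic and quadratic; replacing \<open>u\<close>
  by \<open>- u\<close> gives the other one, so the quadratic divides the cubic. Conversely, given the
  factorisation, \<open>cnj a\<close> lies strictly inside the ellipse, because
  \<open>s^2 - (|cnj a - f| + |cnj a - g|)^2 = 2 (1 - |a|^2) (1 - |b|)\<close> (\<open>szego_roots_ellipse\<close>); thus the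
  linear factor never yields the largest root, \<open>W(A)\<close> and the elliptical disk have the same
  tangents, and they coincide.

  For the pentagram curve, let \<open>m(z) = z (z - cnj a) / (1 - a z)\<close>. The condition that \<open>z\<close> is a zero of
  \<open>z \<Phi>_3 - cnj \<lambda> \<Phi>_3*\<close> depends only on \<open>m(z)\<close> and is quadratic in it. The two points of the circle with
  the same value of \<open>m\<close> are the ends of a chord through \<open>cnj a\<close>. Hence the four zeros form two chords
  through \<open>cnj a\<close>; as these cross inside the disk, the zeros alternate and the chords are the
  diagonals. As \<open>\<lambda>\<close> varies, they are all the chords through \<open>cnj a\<close>, and the envelope of this
  pencil is its centre.
\<close>

section \<open>Ellipses described by their tangents\<close>

text \<open>The real \<open>t\<close> with \<open>ellipse_quad f g D u t = 0\<close> are those for which the line \<open>2 Re (cnj u * z) = t\<close>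
  touches the ellipse with foci \<open>f\<close>, \<open>g\<close> whose major axis \<open>s\<close> satisfies \<open>D = s\<^sup>2 - (dist f g)\<^sup>2\<close>: the
  product of the distances of the foci from a tangent is the square of the minor semi-axis.\<close>

definition ellipse_quad :: "complex \<Rightarrow> complex \<Rightarrow> real \<Rightarrow> complex \<Rightarrow> real \<Rightarrow> real" where
  "ellipse_quad f g D u t = (t - 2 * Re (cnj u * f)) * (t - 2 * Re (cnj u * g)) - D"

lemma unimodular_Re_Im: "cmod u = 1 \<longleftrightarrow> (Re u)\<^sup>2 + (Im u)\<^sup>2 = 1"
  by (simp add: cmod_def)

lemma Re_product_rotated:
  assumes "cmod u = 1"
  shows "4 * Re (cnj u * x) * Re (cnj u * y) = 2 * Re (cnj (u^2) * (x * y)) + 2 * Re (x * cnj y)"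
proof -
  have "(Re u)\<^sup>2 + (Im u)\<^sup>2 = 1" using assms unimodular_Re_Im by blast
  then show ?thesis by (simp add: power2_eq_square) algebra
qed

lemma focal_identity:
  "(cmod x + cmod y)\<^sup>2 - (cmod (x - y))\<^sup>2 = 2 * cmod (x * y) + 2 * Re (x * cnj y)"
proof -
  have "(cmod (x - y))\<^sup>2 = (cmod x)\<^sup>2 + (cmod y)\<^sup>2 - 2 * Re (x * cnj y)"
    unfolding cmod_power2 by (simp add: power2_eq_square algebra_simps)
  then show ?thesis by (simp add: power2_sum norm_mult)
qed

text \<open>The quadratic at the line through \<open>z\<close> never exceeds the difference of squares that decides whether \<open>z\<close> lies
  in the elliptical disk; the deficit on the right vanishes for a suitable \<open>u\<close>.\<close>

lemma ellipse_quad_eq: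
  assumes "cmod u = 1"
  shows "ellipse_quad f g ((s::real)\<^sup>2 - (dist f g)\<^sup>2) u (2 * Re (cnj u * z)) =
    (dist z f + dist z g)\<^sup>2 - s\<^sup>2
      - 2 * (cmod ((z - f) * (z - g)) - Re (cnj (u^2) * ((z - f) * (z - g))))"
proof -
  have "cmod (g - f) = dist f g" by (simp add: dist_norm norm_minus_commute)
  then show ?thesis
    using Re_product_rotated[OF assms, of "z - f" "z - g"] focal_identity[of "z - f" "z - g"]
    by (simp add: ellipse_quad_def dist_norm[symmetric] algebra_simps)
qed

lemma ellipse_quad_le:
  assumes "cmod u = 1"
  shows "ellipse_quad f g (s\<^sup>2 - (dist f g)\<^sup>2) u (2 * Re (cnj u * z)) \<le> (dist z f + dist z g)\<^sup>2 - s\<^sup>2"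
proof -
  have "Re (cnj (u^2) * w) \<le> cmod w" for w
    using complex_Re_le_cmod[of "cnj (u^2) * w"] assms by (simp add: norm_mult norm_power)
  moreover have "X - 2 * (m - r) \<le> X" if "r \<le> m" for X m r :: real using that by simp
  ultimately show ?thesis unfolding ellipse_quad_eq[OF assms] by blast
qed

lemma unimodular_square_root_phase: "\<exists>u. cmod u = 1 \<and> Re (cnj (u^2) * w) = cmod w"
proof -
  obtain r t where w: "w = rcis r t" "r = cmod w" by (metis rcis_cmod_Arg)
  have "cnj ((cis (t/2))^2) * w = of_real r"
    unfolding w(1) by (simp add: power2_eq_square rcis_def cis_cnj cis_mult)
  then show ?thesis using w(2) by (intro exI[of _ "cis (t/2)"]) simp
qed

text \<open>Of all directions \<open>u\<close>, the one bisecting the lines from \<open>z\<close> to the foci makes the quadratic largest, and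
  there it equals \<open>(dist z f + dist z g)\<^sup>2 - s\<^sup>2\<close>.\<close>

lemma ellipse_disk_iff:
  assumes "0 \<le> s"
  shows "dist z f + dist z g \<le> s \<longleftrightarrow>
    (\<forall>u. cmod u = 1 \<longrightarrow> ellipse_quad f g (s\<^sup>2 - (dist f g)\<^sup>2) u (2 * Re (cnj u * z)) \<le> 0)"
    (is "?L \<longleftrightarrow> ?R")
proof
  assume ?L
  then have "(dist z f + dist z g)\<^sup>2 \<le> s\<^sup>2" by (intro power_mono) auto
  then show ?R using ellipse_quad_le by (meson diff_le_0_iff_le order_trans)
next
  assume R: ?R
  \<comment> \<open>The direction in which the correction term vanishes.\<close>
  obtain u where u: "cmod u = 1" "Re (cnj (u^2) * ((z - f) * (z - g))) = cmod ((z - f) * (z - g))"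
    using unimodular_square_root_phase by blast
  have "ellipse_quad f g (s\<^sup>2 - (dist f g)\<^sup>2) u (2 * Re (cnj u * z)) = (dist z f + dist z g)\<^sup>2 - s\<^sup>2"
    unfolding ellipse_quad_eq[OF u(1)] u(2) by simp
  then have "(dist z f + dist z g)\<^sup>2 \<le> s\<^sup>2" using R u(1) by force
  then show ?L using assms by (rule power2_le_imp_le)
qed

text \<open>The larger root of the quadratic; the smaller one is \<open>- ellipse_top f g D (- u)\<close>, since reversing \<open>u\<close>
  and \<open>t\<close> describes the same line.\<close>

definition ellipse_top :: "complex \<Rightarrow> complex \<Rightarrow> real \<Rightarrow> complex \<Rightarrow> real" where
  "ellipse_top f g D u = Re (cnj u * (f + g)) + sqrt (D + (Re (cnj u * (f - g)))\<^sup>2)"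

lemma ellipse_quad_factor:
  assumes "0 < D"
  shows "ellipse_quad f g D u t = (t - ellipse_top f g D u) * (t + ellipse_top f g D (- u))"
    and "- ellipse_top f g D (- u) < ellipse_top f g D u"
proof -
  define q where "q = sqrt (D + (Re (cnj u * (f - g)))\<^sup>2)"
  have q: "q\<^sup>2 = D + (Re (cnj u * (f - g)))\<^sup>2" "0 < q"
    using assms by (auto simp: q_def add_pos_nonneg)
  have q': "ellipse_top f g D u = Re (cnj u * (f + g)) + q"
    "ellipse_top f g D (- u) = - Re (cnj u * (f + g)) + q"
    by (simp_all add: ellipse_top_def q_def power2_eq_square algebra_simps)
  show "ellipse_quad f g D u t = (t - ellipse_top f g D u) * (t + ellipse_top f g D (- u))"
    unfolding q' ellipse_quad_def using q(1) by (simp add: power2_eq_square algebra_simps)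
  show "- ellipse_top f g D (- u) < ellipse_top f g D u"
    unfolding q' using q(2) by simp
qed

text \<open>The point of contact is where the ray from \<open>f\<close>, reflected in the tangent, reaches \<open>g\<close>. In coordinates
  in which the tangent is vertical the reflection law fixes the slope \<open>k\<close> of both rays.\<close>

lemma ellipse_tangent_point:
  assumes "cmod u = 1" "dist f g < s"
  shows "\<exists>z. dist z f + dist z g = s \<and>
    2 * Re (cnj u * z) = ellipse_top f g (s\<^sup>2 - (dist f g)\<^sup>2) u"
proof -
  define D where "D = s\<^sup>2 - (dist f g)\<^sup>2"
  have s: "0 < s" using assms(2) zero_le_dist[of f g] by linarith
  have D: "0 < D" unfolding D_def using assms(2) by (simp add: power_strict_mono)
  define F G where "F = cnj u * f" and "G = cnj u * g"
  define q where "q = sqrt (D + (Re (F - G))\<^sup>2)"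
  have q: "q\<^sup>2 = D + (Re (F - G))\<^sup>2" using D by (simp add: q_def)
  have "\<bar>Re (F - G)\<bar> < q" unfolding q_def using D by (intro real_less_rsqrt) simp
  define T where "T = Re (F + G) + q"
  define d e where "d = T / 2 - Re F" and "e = T / 2 - Re G"
  have de: "0 < d" "0 < e" "d + e = q"
    using \<open>\<bar>_\<bar> < q\<close> by (auto simp: d_def e_def T_def field_simps)
  have uu: "cnj u * u = 1" "u * cnj u = 1"
    using assms(1) complex_norm_square[of u] by (simp_all add: mult.commute)
  define k where "k = (Im G - Im F) / q"
  define Z where "Z = Complex (T / 2) (Im F + d * k)"
  define z where "z = u * Z"
  have uz: "cnj u * z = Z" by (simp add: z_def uu flip: mult.assoc)
  have "dist z w = cmod (cnj u * z - cnj u * w)" for w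
    using assms(1) by (simp add: dist_norm norm_mult flip: right_diff_distrib)
  then have dz: "dist z f = cmod (Z - F)" "dist z g = cmod (Z - G)"
    unfolding uz F_def G_def by auto
  have "Im F + d * k = Im G - e * k"
  proof -
    have "(d + e) * k = Im G - Im F" using de by (simp add: k_def)
    then show ?thesis by (simp add: algebra_simps)
  qed
  then have "Z - F = of_real d * Complex 1 k" "Z - G = of_real e * Complex 1 (- k)"
    by (simp_all add: Z_def d_def e_def complex_eq_iff)
  then have "dist z f + dist z g = q * cmod (Complex 1 k)"
    unfolding dz using de by (simp add: norm_mult complex_norm flip: distrib_right)
  also have "\<dots> = sqrt (q\<^sup>2 + (Im G - Im F)\<^sup>2)"
  proof -
    have "q * cmod (Complex 1 k) = cmod (of_real q * Complex 1 k)"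
      using de by (simp add: norm_mult)
    also have "of_real q * Complex 1 k = Complex q (Im G - Im F)"
      using de by (simp add: complex_eq_iff k_def)
    finally show ?thesis by (simp add: complex_norm)
  qed
  also have "q\<^sup>2 + (Im G - Im F)\<^sup>2 = D + (cmod (F - G))\<^sup>2"
    unfolding q by (simp add: cmod_power2 power2_commute)
  also have "cmod (F - G) = dist f g"
    using assms(1) by (simp add: F_def G_def dist_norm norm_mult flip: right_diff_distrib)
  finally have "dist z f + dist z g = s" using s by (simp add: D_def)
  moreover have "2 * Re (cnj u * z) = ellipse_top f g D u"
    unfolding uz Z_def ellipse_top_def T_def q_def F_def G_def
    by (simp add: algebra_simps)
  ultimately show ?thesis unfolding D_def by blast
qed

lemma ellipse_interior_point_quad:
  assumes "dist f g < s" "dist z f + dist z g < s" "cmod u = 1"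
  shows "2 * Re (cnj u * z) < ellipse_top f g (s\<^sup>2 - (dist f g)\<^sup>2) u"
proof -
  have s: "0 < s" using assms(1) zero_le_dist[of f g] by linarith
  have D: "0 < s\<^sup>2 - (dist f g)\<^sup>2" using assms(1) by (simp add: power_strict_mono)
  have "(dist z f + dist z g)\<^sup>2 < s\<^sup>2" using assms(2) by (intro power_strict_mono) auto
  then have "ellipse_quad f g (s\<^sup>2 - (dist f g)\<^sup>2) u (2 * Re (cnj u * z)) < 0"
    using ellipse_quad_le[OF assms(3), of f g s z] by linarith
  then show ?thesis
    unfolding ellipse_quad_factor(1)[OF D] mult_less_0_iff
    using ellipse_quad_factor(2)[OF D, of f g u] by linarith
qed

text \<open>The sum of the distances is convex and is smallest at the midpoint of the foci, so it increases strictly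
  along rays from the midpoint and no point of the level set is interior to the disk.\<close>

lemma frontier_ellipse_disk:
  fixes f g :: "'a::real_normed_vector"
  assumes "dist f g < s"
  shows "frontier {z. dist z f + dist z g \<le> s} = {z. dist z f + dist z g = (s::real)}"
proof -
  let ?p = "\<lambda>z. dist z f + dist z g"
  have "closed {z. ?p z \<le> s}" by (intro closed_Collect_le continuous_intros)
  have "interior {z. ?p z \<le> s} = {z. ?p z < s}"
  proof
    have "open {z. ?p z < s}" by (intro open_Collect_less continuous_intros)
    then show "{z. ?p z < s} \<subseteq> interior {z. ?p z \<le> s}" by (intro interior_maximal) auto
    show "interior {z. ?p z \<le> s} \<subseteq> {z. ?p z < s}"
    proof
      fix z assume z: "z \<in> interior {z. ?p z \<le> s}"
      define m where "m = midpoint f g"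
      obtain e where e: "e > 0" "ball z e \<subseteq> {z. ?p z \<le> s}" using z by (auto simp: mem_interior)
      have pm: "?p m = dist f g" by (simp add: m_def dist_midpoint)
      have "?p z < s"
      proof (cases "z = m")
        case True then show ?thesis using pm assms by simp
      next
        case False
        define r where "r = e / (2 * dist z m)"
        have r: "0 < r" using e(1) False by (simp add: r_def)
        define y where "y = z + r *\<^sub>R (z - m)"
        have "dist z y < e" using e(1) False by (simp add: y_def r_def dist_norm)
        then have y: "?p y \<le> s" using e(2) by auto
        have zy: "z = (1 / (1 + r)) *\<^sub>R y + (r / (1 + r)) *\<^sub>R m"
        proof -
          have "(1 + r) *\<^sub>R z = y + r *\<^sub>R m" by (simp add: y_def algebra_simps)
          then have "(1 / (1 + r)) *\<^sub>R ((1 + r) *\<^sub>R z) = (1 / (1 + r)) *\<^sub>R (y + r *\<^sub>R m)" by simp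
          then show ?thesis using r by (simp add: scaleR_add_right)
        qed
        have 1: "1 / (1 + r) + r / (1 + r) = 1" using r by (simp add: field_simps)
        have "dist z w \<le> (1 / (1 + r)) * dist y w + (r / (1 + r)) * dist m w" for w
        proof -
          have "z - w = (1 / (1 + r)) *\<^sub>R (y - w) + (r / (1 + r)) *\<^sub>R (m - w)"
          proof -
            have "w = (1 / (1 + r)) *\<^sub>R w + (r / (1 + r)) *\<^sub>R w"
              using 1 by (simp flip: scaleR_add_left)
            then show ?thesis using zy by (metis add_diff_add scaleR_diff_right)
          qed
          then show ?thesis
            using norm_triangle_ineq[of "(1 / (1 + r)) *\<^sub>R (y - w)" "(r / (1 + r)) *\<^sub>R (m - w)"] r
            by (simp add: dist_norm)
        qed
        from this[of f] this[of g] have "?p z \<le> (1 / (1 + r)) * ?p y + (r / (1 + r)) * ?p m"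
          by (simp add: distrib_left)
        also have "\<dots> < (1 / (1 + r)) * s + (r / (1 + r)) * s"
          using y r assms unfolding pm
          by (intro add_le_less_mono mult_left_mono mult_strict_left_mono) auto
        also have "\<dots> = s" using 1 by (metis distrib_right mult_1)
        finally show ?thesis .
      qed
      then show "z \<in> {z. ?p z < s}" by simp
    qed
  qed
  then show ?thesis
    unfolding frontier_def closure_closed[OF \<open>closed _\<close>] by auto
qed

text \<open>Half-planes determine a compact convex set, so equal tangents mean equal sets. One inclusion is
  \<open>ellipse_disk_iff\<close> and the other one is separation by a hyperplane.\<close>

lemma convex_compact_eq_ellipse_disk:
  fixes W :: "complex set"
  assumes "compact W" "convex W" "W \<noteq> {}" and fg: "dist f g < s"
    and top: "\<And>u w. cmod u = 1 \<Longrightarrow> w \<in> W \<Longrightarrow>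
          2 * Re (cnj u * w) \<le> ellipse_top f g (s\<^sup>2 - (dist f g)\<^sup>2) u"
    and attained: "\<And>u. cmod u = 1 \<Longrightarrow>
          \<exists>w\<in>W. 2 * Re (cnj u * w) = ellipse_top f g (s\<^sup>2 - (dist f g)\<^sup>2) u"
  shows "W = {z. dist z f + dist z g \<le> s}"
proof -
  define D where "D = s\<^sup>2 - (dist f g)\<^sup>2"
  have s: "0 < s" using fg zero_le_dist[of f g] by linarith
  have D: "0 < D" unfolding D_def using fg by (simp add: power_strict_mono)
  show ?thesis
  proof
    show "W \<subseteq> {z. dist z f + dist z g \<le> s}"
    proof
      fix z assume z: "z \<in> W"
      have "ellipse_quad f g D u (2 * Re (cnj u * z)) \<le> 0" if u: "cmod u = 1" for u
        unfolding ellipse_quad_factor(1)[OF D]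
        using top[OF u z] top[of "- u", OF _ z] u
        by (intro mult_nonpos_nonneg) (auto simp: D_def)
      then show "z \<in> {z. dist z f + dist z g \<le> s}"
        using ellipse_disk_iff[of s z f g] s unfolding D_def by auto
    qed
    show "{z. dist z f + dist z g \<le> s} \<subseteq> W"
    proof (rule subsetI, rule ccontr)
      fix z assume z: "z \<in> {z. dist z f + dist z g \<le> s}" "z \<notin> W"
      obtain v b where v: "inner v z < b" "\<And>w. w \<in> W \<Longrightarrow> b < inner v w"
        using separating_hyperplane_closed_point[OF assms(2) compact_imp_closed[OF assms(1)] z(2)] by blast
      have v0: "v \<noteq> 0" using v assms(3) by force
      define u where "u = - v / of_real (cmod v)"
      have u: "cmod u = 1" using v0 by (simp add: u_def norm_divide)
      have inner: "Re (cnj u * w) = - inner v w / cmod v" for w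
        by (simp add: u_def inner_complex_def divide_simps)
      obtain w where w: "w \<in> W" "2 * Re (cnj u * w) = ellipse_top f g D u"
        using attained[OF u] unfolding D_def by blast
      have "inner v z < inner v w" using v w(1) by force
      then have "Re (cnj u * w) < Re (cnj u * z)"
        unfolding inner using v0 by (simp add: divide_strict_right_mono)
      then have "0 < ellipse_quad f g D u (2 * Re (cnj u * z))"
        unfolding ellipse_quad_factor(1)[OF D]
        using w(2) ellipse_quad_factor(2)[OF D, of f g u] by (intro mult_pos_pos) auto
      then show False using ellipse_disk_iff[of s z f g] s z(1) u unfolding D_def by force
    qed
  qed
qed

section \<open>Convexity of the numerical range\<close>

text \<open>The form \<open>\<langle>x, A y\<rangle>\<close>, linear in the second argument.\<close>

definition sesq :: "complex^'n^'n \<Rightarrow> complex^'n \<Rightarrow> complex^'n \<Rightarrow> complex" where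
  "sesq A x y = (\<Sum>i\<in>UNIV. cnj (x $ i) * (A *v y) $ i)"

lemma sesq_add_left: "sesq A (x + y) z = sesq A x z + sesq A y z"
  by (simp add: sesq_def distrib_right sum.distrib)

lemma sesq_add_right: "sesq A x (y + z) = sesq A x y + sesq A x z"
  by (simp add: sesq_def matrix_vector_right_distrib distrib_left sum.distrib)

lemma sesq_scale_left: "sesq A (c *s x) y = cnj c * sesq A x y"
  by (simp add: sesq_def sum_distrib_left mult.assoc)

lemma sesq_scale_right: "sesq A x (c *s y) = c * sesq A x y"
  by (simp add: sesq_def sum_distrib_left vector_scalar_commute mult.left_commute)

lemma sesq_diff_matrix: "sesq (A - B) x y = sesq A x y - sesq B x y"
  by (simp add: sesq_def matrix_vector_mult_diff_rdistrib right_diff_distrib sum_subtractf)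

lemmas sesq_simps = sesq_add_left sesq_add_right sesq_scale_left sesq_scale_right sesq_diff_matrix

lemma sesq_mat: "sesq (mat c) x y = c * (\<Sum>i\<in>UNIV. cnj (x $ i) * y $ i)"
proof -
  have "(mat c *v y) $ i = c * y $ i" for i
    by (simp add: matrix_vector_mult_def mat_def if_distrib[of "\<lambda>a. a * _"] cong: if_cong)
  then show ?thesis by (simp add: sesq_def sum_distrib_left mult.left_commute)
qed

lemma sesq_mat_self: "sesq (mat c) x x = c * of_real ((norm x)\<^sup>2)"
proof -
  have "(\<Sum>i\<in>UNIV. cnj (x $ i) * x $ i) = of_real ((norm x)\<^sup>2)"
    unfolding norm_vec_def L2_set_def
    by (simp add: sum_nonneg complex_norm_square mult.commute del: of_real_power)
  then show ?thesis by (simp add: sesq_mat)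
qed

lemma continuous_on_sesq_self: "continuous_on S (\<lambda>x. sesq A x x)"
  unfolding sesq_def matrix_vector_mult_def by (auto intro!: continuous_intros)

lemma numerical_range_sesq: "numerical_range A = (\<lambda>x. sesq A x x) ` sphere 0 1"
  by (auto simp: numerical_range_def sesq_def image_iff)

lemma numerical_rangeI:
  assumes "x \<noteq> 0" "sesq A x x = w * of_real ((norm x)\<^sup>2)"
  shows "w \<in> numerical_range A"
proof -
  define r where "r = complex_of_real (inverse (norm x))"
  have r: "r *s x = inverse (norm x) *\<^sub>R x"
    unfolding r_def by (simp add: vec_eq_iff scaleR_conv_of_real[where 'a = complex])
  have "norm (r *s x) = 1" unfolding r using assms(1) by simp
  moreover have "sesq A (r *s x) (r *s x) = w"
    using assms by (simp add: sesq_simps r_def field_simps power2_eq_square)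
  ultimately show ?thesis unfolding numerical_range_sesq by force
qed

lemma compact_numerical_range: "compact (numerical_range A)"
  unfolding numerical_range_sesq
  by (intro compact_continuous_image continuous_on_sesq_self compact_sphere)

lemma numerical_range_nonempty: "numerical_range A \<noteq> {}"
  unfolding numerical_range_sesq by simp

text \<open>The phase that makes the mixed terms of the form real in the proof of convexity.\<close>

lemma unimodular_makes_real: "\<exists>c. cmod c = 1 \<and> Im (c * P + cnj c * Q) = 0"
proof (cases "P = cnj Q")
  case True
  then show ?thesis by (intro exI[of _ 1]) simp
next
  case False
  define d where "d = P - cnj Q"
  have d: "d \<noteq> 0" using False by (simp add: d_def)
  let ?c = "cnj d / of_real (cmod d)"
  have "Im (?c * P + cnj ?c * Q) = Im (?c * d)"
    by (simp add: d_def algebra_simps add_divide_distrib diff_divide_distrib)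
  also have "?c * d = of_real (cmod d)"
    using d complex_norm_square[of d] by (simp add: field_simps power2_eq_square)
  finally have "Im (?c * P + cnj ?c * Q) = 0" by simp
  moreover have "cmod ?c = 1" using d by (simp add: norm_divide)
  ultimately show ?thesis by blast
qed

text \<open>The Toeplitz--Hausdorff theorem. After subtracting \<open>p\<close> and dividing by \<open>q - p\<close> the two given values become
  0 and 1. With the right relative phase of the two vectors, the form is real along the segment joining
  them, and the intermediate value theorem applies to the normalised values.\<close>

theorem convex_numerical_range: "convex (numerical_range A)"
proof (rule convexI)
  fix p q :: complex and u v :: real
  assume pq: "p \<in> numerical_range A" "q \<in> numerical_range A" and uv: "0 \<le> u" "0 \<le> v" "u + v = 1"
  show "u *\<^sub>R p + v *\<^sub>R q \<in> numerical_range A"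
  proof (cases "p = q")
    case True
    then show ?thesis using pq uv by (simp flip: scaleR_left_distrib)
  next
    case False
    obtain x y where x: "norm x = 1" "sesq A x x = p" and y: "norm y = 1" "sesq A y y = q"
      using pq unfolding numerical_range_sesq by auto
    define B where "B = A - mat p"
    obtain c where c: "cmod c = 1" and
      real: "Im (c * (sesq B x y / (q - p)) + cnj c * (sesq B y x / (q - p))) = 0"
      using unimodular_makes_real by blast
    \<comment> \<open>The mixed terms, measured in units of \<open>q - p\<close>.\<close>
    define r where "r = Re (c * (sesq B x y / (q - p)) + cnj c * (sesq B y x / (q - p)))"
    have "of_real r = c * (sesq B x y / (q - p)) + cnj c * (sesq B y x / (q - p))"
      using real by (simp add: r_def complex_eq_iff)
    then have r: "c * sesq B x y + cnj c * sesq B y x = of_real r * (q - p)"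
    proof -
      have "(c * (P / w) + cnj c * (Q / w)) * w = c * P + cnj c * Q" if "w \<noteq> 0" for P Q w
        using that by (simp add: field_simps)
      then show ?thesis using False \<open>of_real r = _\<close> by simp
    qed
    define z where "z t = of_real (1 - t) *s x + (of_real t * c) *s y" for t
    have Bx: "sesq B x x = 0" and By: "sesq B y y = q - p"
      using x y by (simp_all add: B_def sesq_simps sesq_mat_self)
    have cc: "c * cnj c = 1" using c complex_norm_square[of c] by simp
    have sBz: "sesq B (z t) (z t) = of_real (t * (1 - t)) * (c * sesq B x y + cnj c * sesq B y x)
        + of_real (t^2) * (c * cnj c) * sesq B y y" for t
      unfolding z_def sesq_simps Bx by (simp add: algebra_simps power2_eq_square)
    have Bz: "sesq B (z t) (z t) = of_real (t * (1 - t) * r + t^2) * (q - p)" for t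
      unfolding sBz r By cc by (simp add: algebra_simps)
    have z0: "z t \<noteq> 0" for t
    proof
      assume z: "z t = 0"
      show False
      proof (cases "t = 0")
        case True
        have "z 0 = x" by (simp add: z_def vec_eq_iff)
        then show False using z x \<open>t = 0\<close> by auto
      next
        case t: False
        define m where "m = - of_real (1 - t) / (of_real t * c)"
        have c0: "c \<noteq> 0" using c by auto
        have "y = m *s x"
        proof -
          have "of_real (1 - t) * x $ i + (of_real t * c) * y $ i = 0" for i
            using z unfolding z_def vec_eq_iff by (simp add: left_diff_distrib)
          then have "y $ i = m * x $ i" for i
            using t c0 unfolding m_def by (simp add: field_simps eq_neg_iff_add_eq_0)
          then show ?thesis by (simp add: vec_eq_iff)
        qed
        then have "sesq M y y = (cnj m * m) * sesq M x x" for M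
          by (simp add: sesq_simps)
        from this[of "mat 1"] this[of A] have "q = p"
          using x y by (simp add: sesq_mat_self)
        then show False using False by simp
      qed
    qed
    define F where "F t = (t * (1 - t) * r + t^2) / (norm (z t))^2" for t
    have "continuous_on UNIV z"
      unfolding z_def vector_scalar_mult_def
      by (intro continuous_intros continuous_on_vec_lambda)
    then have "isCont z t" for t by (simp add: continuous_on_eq_continuous_at)
    then have cont: "\<forall>t. 0 \<le> t \<and> t \<le> 1 \<longrightarrow> isCont F t"
      unfolding F_def using z0 by (auto intro!: continuous_intros)
    have "z 0 = x" by (simp add: z_def vec_eq_iff)
    have "z 1 = c *s y" by (simp add: z_def vec_eq_iff)
    then have "of_real ((norm (z 1))^2) = sesq (mat 1) (c *s y) (c *s y)" 
      by (simp add: sesq_mat_self)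
    also have "\<dots> = 1" using cc y by (simp add: sesq_simps sesq_mat_self mult.commute)
    finally have "complex_of_real ((norm (z 1))^2) = of_real 1" by simp
    then have "(norm (z 1))^2 = 1" unfolding of_real_eq_iff .
    then have F: "F 0 = 0" "F 1 = 1" using \<open>z 0 = x\<close> x by (simp_all add: F_def)
    obtain t where t: "F t = v"
      using IVT[of F 0 v 1, OF _ _ _ cont] F uv by auto
    have "sesq B (z t) (z t) = of_real (v * (norm (z t))^2) * (q - p)"
    proof -
      have "t * (1 - t) * r + t\<^sup>2 = v * (norm (z t))\<^sup>2"
        using t z0[of t] unfolding F_def by (simp add: divide_eq_eq)
      then show ?thesis unfolding Bz by simp
    qed
    then have "sesq A (z t) (z t) = (p + v * (q - p)) * of_real ((norm (z t))^2)"
      by (simp add: B_def sesq_simps sesq_mat_self algebra_simps)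
    then have "p + v * (q - p) \<in> numerical_range A" using z0 numerical_rangeI by blast
    moreover have "u *\<^sub>R p + v *\<^sub>R q = p + v * (q - p)"
    proof -
      have "u = 1 - v" using uv(3) by simp
      show ?thesis unfolding \<open>u = 1 - v\<close> by (simp add: scaleR_conv_of_real algebra_simps)
    qed
    ultimately show ?thesis by simp
  qed
qed

section \<open>Tangents of the numerical range\<close>

lemma det_eq_0_iff_kernel:
  fixes M :: "'a::field^'n^'n"
  shows "det M = 0 \<longleftrightarrow> (\<exists>x. x \<noteq> 0 \<and> M *v x = 0)"
  using invertible_det_nz[of M] matrix_left_invertible_ker[of M] invertible_left_inverse[of M]
  by auto

text \<open>The Hermitian matrix \<open>cnj u A + u A*\<close>, whose quadratic form is \<open>2 Re (cnj u * \<langle>x, A x\<rangle>)\<close>.\<close>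

definition rotated_sum :: "complex \<Rightarrow> complex^'n^'n \<Rightarrow> complex^'n^'n" where
  "rotated_sum u A = (\<chi> i j. cnj u * A $ i $ j + u * cnj (A $ j $ i))"

lemma sesq_rotated_sum:
  "sesq (rotated_sum u A) x y = cnj u * sesq A x y + u * cnj (sesq A y x)"
proof -
  have "sesq (rotated_sum u A) x y =
      (\<Sum>i\<in>UNIV. \<Sum>j\<in>UNIV. cnj u * (cnj (x $ i) * (A $ i $ j * y $ j)))
      + (\<Sum>i\<in>UNIV. \<Sum>j\<in>UNIV. u * (cnj (x $ i) * (cnj (A $ j $ i) * y $ j)))"
    by (simp add: sesq_def rotated_sum_def matrix_vector_mult_def sum_distrib_left
        algebra_simps flip: sum.distrib)
  also have "(\<Sum>i\<in>UNIV. \<Sum>j\<in>UNIV. u * (cnj (x $ i) * (cnj (A $ j $ i) * y $ j)))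
      = u * cnj (sesq A y x)"
    by (subst sum.swap) (simp add: sesq_def matrix_vector_mult_def sum_distrib_left algebra_simps)
  finally show ?thesis
    by (simp add: sesq_def matrix_vector_mult_def sum_distrib_left)
qed

text \<open>A nonnegative Hermitian form \<open>M\<close> that vanishes at \<open>x\<close> has \<open>M x = 0\<close>: otherwise a small step from \<open>x\<close> in
  the direction \<open>- M x\<close> would make it negative.\<close>

lemma det_zero_at_support:
  assumes upper: "\<And>w. w \<in> numerical_range A \<Longrightarrow> 2 * Re (cnj u * w) \<le> t"
    and w: "w \<in> numerical_range A" "2 * Re (cnj u * w) = t"
  shows "det (mat (of_real t) - rotated_sum u A) = 0"
proof -
  define M where "M = mat (of_real t) - rotated_sum u A"
  have M: "sesq M y y = of_real (t * (norm y)\<^sup>2 - 2 * Re (cnj u * sesq A y y))" for y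
    by (simp add: M_def sesq_diff_matrix sesq_mat_self sesq_rotated_sum complex_eq_iff)
  have nonneg: "0 \<le> Re (sesq M y y)" for y
  proof (cases "y = 0")
    case True
    then show ?thesis by (simp add: sesq_def)
  next
    case False
    define v where "v = sesq A y y / of_real ((norm y)\<^sup>2)"
    have v: "sesq A y y = v * of_real ((norm y)\<^sup>2)" using False by (simp add: v_def)
    then have "2 * Re (cnj u * v) \<le> t" using upper numerical_rangeI[OF False] by blast
    moreover have "Re (sesq M y y) = (t - 2 * Re (cnj u * v)) * (norm y)\<^sup>2"
      unfolding M v by (simp add: algebra_simps)
    ultimately show ?thesis by simp
  qed
  obtain x where x: "norm x = 1" "w = sesq A x x"
    using w(1) unfolding numerical_range_sesq by auto
  have Mx: "sesq M x x = 0" unfolding M using x w(2) by simp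
  define v where "v = M *v x"
  have vv: "sesq M v x = of_real ((norm v)\<^sup>2)"
    using sesq_mat_self[of 1 v] by (simp add: sesq_mat) (simp add: sesq_def v_def)
  have "sesq M x v = cnj (sesq M v x)"
    by (simp add: M_def sesq_diff_matrix sesq_rotated_sum sesq_mat mult.commute)
  then have xv: "sesq M x v = of_real ((norm v)\<^sup>2)" by (simp add: vv)
  define m where "m = Re (sesq M v v)"
  have m: "sesq M v v = of_real m" unfolding m_def M by simp
  have m0: "0 \<le> m" unfolding m_def by (rule nonneg)
  have step: "0 \<le> 2 * e * (norm v)\<^sup>2 + e\<^sup>2 * m" for e :: real
  proof -
    have "sesq M (x + of_real e *s v) (x + of_real e *s v) = of_real (2 * e * (norm v)\<^sup>2 + e\<^sup>2 * m)"
      by (simp add: sesq_simps Mx vv xv m power2_eq_square algebra_simps)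
    then show ?thesis using nonneg[of "x + of_real e *s v"] by simp
  qed
  have "norm v = 0"
  proof (rule ccontr)
    assume "norm v \<noteq> 0"
    define n where "n = (norm v)\<^sup>2"
    have n: "0 < n" using \<open>norm v \<noteq> 0\<close> by (simp add: n_def)
    \<comment> \<open>The minimum over the step length is at \<open>- n / m\<close>; the denominator \<open>m + 1\<close> also covers \<open>m = 0\<close>.\<close>
    have "0 \<le> 2 * (- n / (m + 1)) * n + (- n / (m + 1))\<^sup>2 * m"
      using step unfolding n_def by blast
    also have "\<dots> = - (n\<^sup>2 * (m + 2) / (m + 1)\<^sup>2)"
    proof -
      have "m + 1 \<noteq> 0" using m0 by simp
      then show ?thesis by (simp add: divide_simps power2_eq_square) algebra
    qed
    also have "\<dots> < 0" using n m0 by simp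
    finally show False by simp
  qed
  then have "M *v x = 0" by (simp add: v_def)
  then show ?thesis using det_eq_0_iff_kernel[of M] x(1) unfolding M_def
    by (metis norm_zero zero_neq_one)
qed

lemma det_zero_attained:
  assumes "det (mat (of_real t) - rotated_sum u A) = 0"
  shows "\<exists>w\<in>numerical_range A. 2 * Re (cnj u * w) = t"
proof -
  obtain x where x: "x \<noteq> 0" "(mat (of_real t) - rotated_sum u A) *v x = 0"
    using assms det_eq_0_iff_kernel by blast
  define v where "v = sesq A x x / of_real ((norm x)\<^sup>2)"
  have v: "sesq A x x = v * of_real ((norm x)\<^sup>2)" using x(1) by (simp add: v_def)
  have "sesq (mat (of_real t) - rotated_sum u A) x x = 0" unfolding sesq_def x(2) by simp
  then have "of_real t * of_real ((norm x)\<^sup>2) = cnj u * sesq A x x + u * cnj (sesq A x x)"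
    by (simp add: sesq_diff_matrix sesq_mat_self sesq_rotated_sum)
  also have "\<dots> = of_real (2 * Re (cnj u * v)) * of_real ((norm x)\<^sup>2)"
    unfolding v by (simp add: complex_eq_iff algebra_simps)
  finally have "complex_of_real t = of_real (2 * Re (cnj u * v))" using x(1) by simp
  then have "t = 2 * Re (cnj u * v)" unfolding of_real_eq_iff .
  then show ?thesis using numerical_rangeI[OF x(1) v] by auto
qed

section \<open>The Kippenhahn cubic of a matrix with rank-one defect\<close>

definition minor_sum :: "'a::idom^3^3 \<Rightarrow> 'a" where
  "minor_sum A = (A$1$1 * A$2$2 - A$1$2 * A$2$1) + (A$1$1 * A$3$3 - A$1$3 * A$3$1)
     + (A$2$2 * A$3$3 - A$2$3 * A$3$2)"

text \<open>The trace of \<open>adj A B\<close>, where \<open>adj A = A\<^sup>2 - tr A A + minor_sum A I\<close> by Cayley--Hamilton.\<close>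

definition mixed_trace :: "'a::idom^3^3 \<Rightarrow> 'a^3^3 \<Rightarrow> 'a" where
  "mixed_trace A B = trace (A ** (A ** B)) - trace A * trace (A ** B) + minor_sum A * trace B"

lemma det_linear_pencil:
  fixes A B :: "'a::idom^3^3"
  shows "det (\<chi> i j. (if i = j then t else 0) - v * A$i$j - u * B$i$j) =
    t^3 - (v * trace A + u * trace B) * t^2
      + (v^2 * minor_sum A + u * v * (trace A * trace B - trace (A ** B)) + u^2 * minor_sum B) * t
      - (v^3 * det A + u * v^2 * mixed_trace A B + u^2 * v * mixed_trace B A + u^3 * det B)"
  by (simp add: det_3 trace_def sum_3 matrix_matrix_mult_def minor_sum_def mixed_trace_def) algebra

lemma charpoly_3:
  fixes A :: "'a::idom^3^3"
  shows "charpoly A = [:- det A, minor_sum A, - trace A, 1:]"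
  by (simp add: charpoly_def det_3 trace_def sum_3 minor_sum_def) (simp add: algebra_simps)

text \<open>For \<open>C = A B = I - x y\<^sup>T\<close> the eigenvalues are 1, 1 and \<open>det C\<close>, which gives the first trace. For the second one,
  the adjugate of \<open>C\<close> is \<open>(1 + det C) I - C\<close>, while \<open>adj C A = adj B adj A A = det A adj B\<close>; take traces.\<close>

lemma trace_adjugate:
  fixes A B :: "'a::idom^3^3"
  assumes "\<And>i j. (A ** B)$i$j = (if i = j then 1 else 0) - x i * y j"
  shows "trace (A ** B) = 2 + det A * det B"
    and "trace (A ** (A ** B)) = trace A * (1 + det A * det B) - det A * minor_sum B"
proof -
  define C where "C = A ** B"
  have C: "C$i$j = (if i = j then 1 else 0) - x i * y j" for i j
    using assms by (simp add: C_def)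
  have "det C = det A * det B" unfolding C_def by (rule det_mul)
  moreover have "trace C = 2 + det C"
    by (simp add: det_3 trace_def sum_3 C) algebra
  ultimately show 1: "trace (A ** B) = 2 + det A * det B" by (simp add: C_def)
  \<comment> \<open>The trace of \<open>adj C A = det A adj B\<close>, with \<open>adj C\<close> written out by Cayley--Hamilton.\<close>
  have "det A * minor_sum B = minor_sum C * trace A - trace C * trace (C ** A) + trace (C ** (C ** A))"
    unfolding C_def
    by (simp add: det_3 trace_def sum_3 matrix_matrix_mult_def minor_sum_def) algebra
  also have "\<dots> = (det C + 1) * trace A - trace (A ** C)"
    by (simp add: det_3 trace_def sum_3 matrix_matrix_mult_def minor_sum_def C) algebra
  finally show "trace (A ** (A ** B)) = trace A * (1 + det A * det B) - det A * minor_sum B"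
    using \<open>det C = _\<close> by (simp add: C_def algebra_simps)
qed

lemma rank_1_entries:
  fixes N :: "'a::field^'n^'m"
  assumes "rank N = 1"
  shows "\<exists>x y. \<forall>i j. N $ i $ j = x i * y j"
proof -
  obtain B where B: "rows N \<subseteq> vec.span B" "card B = vec.dim (rows N)"
    using vec.basis_exists by metis
  then obtain y where "B = {y}" using assms unfolding row_rank_def_gen by (auto simp: card_1_singleton_iff)
  then have "\<exists>k. N $ i = k *s y" for i
    using B(1) unfolding rows_def row_def by (auto simp: vec.span_singleton)
  then obtain x where "N $ i = x i *s y" for i by metis
  then have "\<forall>i j. N $ i $ j = x i * y $ j" by simp
  then show ?thesis by blast
qed

text \<open>The determinant \<open>det (t - cnj u A - u A*)\<close> of a 3 by 3 matrix whose defect \<open>I - A A*\<close>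
  has rank one, in terms of its trace \<open>\<tau>\<close>, second coefficient \<open>\<sigma>\<close> and determinant \<open>\<delta>\<close>.\<close>

definition kippenhahn :: "complex \<Rightarrow> complex \<Rightarrow> complex \<Rightarrow> complex \<Rightarrow> real \<Rightarrow> real" where
  "kippenhahn \<tau> \<sigma> \<delta> u t = t^3 - 2 * Re (cnj u * \<tau>) * t\<^sup>2
     + (2 * Re (cnj u ^ 2 * \<sigma>) + (cmod \<tau>)\<^sup>2 - 2 - (cmod \<delta>)\<^sup>2) * t
     - 2 * Re (cnj u ^ 3 * \<delta> + cnj u * (\<sigma> * cnj \<tau> - \<tau> - \<delta> * cnj \<sigma>))"

lemma of_real_kippenhahn:
  "complex_of_real (kippenhahn \<tau> \<sigma> \<delta> u t) =
      of_real t^3 - (cnj u * \<tau> + u * cnj \<tau>) * of_real t^2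
      + (cnj u ^2 * \<sigma> + (\<tau> * cnj \<tau> - (2 + \<delta> * cnj \<delta>)) + u^2 * cnj \<sigma>) * of_real t
      - (cnj u ^3 * \<delta> + cnj u * (\<sigma> * cnj \<tau> - \<tau> - \<delta> * cnj \<sigma>)
         + u * cnj (\<sigma> * cnj \<tau> - \<tau> - \<delta> * cnj \<sigma>) + u^3 * cnj \<delta>)"
proof -
  have expand: "complex_of_real (t^3 - 2 * Re w1 * t\<^sup>2 + (2 * Re w2 + X - 2 - Y) * t - 2 * Re w3) =
      of_real t^3 - (w1 + cnj w1) * of_real t^2
      + (w2 + cnj w2 + of_real X - 2 - of_real Y) * of_real t - (w3 + cnj w3)" for w1 w2 w3 X Y
    by (simp add: complex_add_cnj)
  show ?thesis
    unfolding kippenhahn_def expand complex_norm_square by (simp add: algebra_simps)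
qed

lemma cadjoint_invariants:
  fixes A :: "complex^3^3"
  shows "trace (cadjoint A) = cnj (trace A)" "det (cadjoint A) = cnj (det A)"
    "minor_sum (cadjoint A) = cnj (minor_sum A)"
    "trace (cadjoint A ** (cadjoint A ** A)) = cnj (trace (A ** (A ** cadjoint A)))"
  by (simp_all add: cadjoint_def trace_def det_3 minor_sum_def sum_3 matrix_matrix_mult_def
      algebra_simps)

text \<open>Besides the coefficients of the characteristic polynomial, the determinant of the pencil involves the traces
  of \<open>A A*\<close> and \<open>adj A A*\<close>, which \<open>trace_adjugate\<close> expresses by those coefficients.\<close>

lemma det_rotated_sum:
  fixes A :: "complex^3^3"
  assumes "rank (mat 1 - A ** cadjoint A) = 1" "cmod u = 1"
  shows "det (mat (of_real t) - rotated_sum u A) =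
    of_real (kippenhahn (trace A) (minor_sum A) (det A) u t)"
proof -
  define B where "B = cadjoint A"
  obtain x y where xy: "\<And>i j. (mat 1 - A ** B) $ i $ j = x i * y j"
    using rank_1_entries[OF assms(1)] unfolding B_def by metis
  have AB: "(A ** B) $ i $ j = (if i = j then 1 else 0) - x i * y j" for i j
    using xy[of i j] by (simp add: mat_def algebra_simps)
  define \<tau> \<sigma> \<delta> where "\<tau> = trace A" and "\<sigma> = minor_sum A" and "\<delta> = det A"
  have B: "trace B = cnj \<tau>" "minor_sum B = cnj \<sigma>" "det B = cnj \<delta>"
    by (simp_all add: B_def \<tau>_def \<sigma>_def \<delta>_def cadjoint_invariants)
  have tAB: "trace (A ** B) = 2 + \<delta> * cnj \<delta>" "trace (B ** A) = 2 + \<delta> * cnj \<delta>"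
    using trace_adjugate(1)[OF AB] B by (simp_all add: \<delta>_def trace_mul_sym[of B A])
  have tAAB: "trace (A ** (A ** B)) = \<tau> * (1 + \<delta> * cnj \<delta>) - \<delta> * cnj \<sigma>"
    using trace_adjugate(2)[OF AB] B by (simp add: \<tau>_def \<delta>_def)
  have tBBA: "trace (B ** (B ** A)) = cnj (trace (A ** (A ** B)))"
    by (simp add: B_def cadjoint_invariants)
  have mixed: "mixed_trace A B = \<sigma> * cnj \<tau> - \<tau> - \<delta> * cnj \<sigma>"
    "mixed_trace B A = cnj (\<sigma> * cnj \<tau> - \<tau> - \<delta> * cnj \<sigma>)"
    unfolding mixed_trace_def tBBA tAAB tAB B
    by (simp_all add: \<tau>_def[symmetric] \<sigma>_def[symmetric] algebra_simps)
  have uu: "u * cnj u = 1" "cnj u * u = 1"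
    using assms(2) complex_norm_square[of u] by (simp_all add: mult.commute)
  have uu2: "u * cnj u ^ 2 = cnj u" "u ^ 2 * cnj u = u"
    using uu by (simp_all add: power2_eq_square mult.assoc[symmetric])
  have "mat (of_real t) - rotated_sum u A =
      (\<chi> i j. (if i = j then of_real t else 0) - cnj u * A$i$j - u * B$i$j)"
    by (simp add: vec_eq_iff mat_def rotated_sum_def B_def cadjoint_def)
  then have "det (mat (of_real t) - rotated_sum u A) =
      of_real t^3 - (cnj u * \<tau> + u * cnj \<tau>) * of_real t^2
      + (cnj u ^2 * \<sigma> + (\<tau> * cnj \<tau> - (2 + \<delta> * cnj \<delta>)) + u^2 * cnj \<sigma>) * of_real t
      - (cnj u ^3 * \<delta> + cnj u * (\<sigma> * cnj \<tau> - \<tau> - \<delta> * cnj \<sigma>)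
         + u * cnj (\<sigma> * cnj \<tau> - \<tau> - \<delta> * cnj \<sigma>) + u^3 * cnj \<delta>)"
    by (simp only: det_linear_pencil mixed tAB B uu uu2 mult_1 flip: \<tau>_def \<sigma>_def \<delta>_def)
  also have "\<dots> = of_real (kippenhahn \<tau> \<sigma> \<delta> u t)"
    by (rule of_real_kippenhahn[symmetric])
  finally show ?thesis unfolding \<tau>_def \<sigma>_def \<delta>_def .
qed

section \<open>Elliptical numerical ranges\<close>

text \<open>The value that \<open>s\<^sup>2 - (dist f g)\<^sup>2\<close> must have for the coefficients of \<open>t\<close> to agree in \<open>kippenhahn_factor\<close>.\<close>

definition focal_constant :: "complex \<Rightarrow> complex \<Rightarrow> complex \<Rightarrow> real" where
  "focal_constant c f g = 2 + (cmod (c * f * g))\<^sup>2 - (cmod c)\<^sup>2 - (cmod f)\<^sup>2 - (cmod g)\<^sup>2"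

text \<open>Its vanishing is the condition on the eigenvalues under which the Kippenhahn cubic splits off the
  quadratic of an ellipse with foci \<open>f\<close> and \<open>g\<close>.\<close>

definition focal_defect :: "complex \<Rightarrow> complex \<Rightarrow> complex \<Rightarrow> complex" where
  "focal_defect c f g = c * (1 - (f * g) * cnj (f * g)) - (f + g) + (f * g) * cnj (f + g)"

text \<open>The coefficients of \<open>t\<^sup>2\<close> agree, those of \<open>t\<close> agree by the choice of the constant, and in the constant
  coefficient the terms with \<open>cnj u ^ 3\<close> and \<open>u ^ 3\<close> agree. What is left are the terms with \<open>cnj u\<close> and \<open>u\<close>.\<close>

lemma kippenhahn_factor:
  assumes "cmod u = 1"
  shows "kippenhahn (c + f + g) (f * g + c * (f + g)) (c * f * g) u t =
    (t - 2 * Re (cnj u * c)) * ellipse_quad f g (focal_constant c f g) u t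
      - 2 * Re (cnj u * ((1 - c * cnj c) * focal_defect c f g))"
proof -
  have uu: "u * cnj u = 1"
    using assms complex_norm_square[of u] by simp
  define v c' f' g' T where "v = cnj u" and "c' = cnj c" and "f' = cnj f" and "g' = cnj g"
    and "T = complex_of_real t"
  have cc: "cnj u = v" "cnj c = c'" "cnj f = f'" "cnj g = g'" "cnj v = u"
    "cnj c' = c" "cnj f' = f" "cnj g' = g"
    by (simp_all add: v_def c'_def f'_def g'_def)
  have re: "complex_of_real (2 * Re w) = w + cnj w" for w by (simp add: complex_eq_iff)
  have "complex_of_real ((t - 2 * Re (cnj u * c)) * ellipse_quad f g (focal_constant c f g) u t
      - 2 * Re (cnj u * ((1 - c * cnj c) * focal_defect c f g)))
    = (T - (v * c + u * c')) * ((T - (v * f + u * f')) * (T - (v * g + u * g'))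
        - (2 + c * f * g * (c' * f' * g') - c * c' - f * f' - g * g'))
      - (v * ((1 - c * c') * (c * (1 - (f * g) * (f' * g')) - (f + g) + (f * g) * (f' + g')))
        + u * ((1 - c' * c) * (c' * (1 - (f' * g') * (f * g)) - (f' + g') + (f' * g') * (f + g))))"
    unfolding ellipse_quad_def focal_constant_def focal_defect_def
      of_real_diff of_real_mult[of "_ - _"] of_real_add complex_norm_square re
    by (simp add: cc T_def[symmetric])
  also have "\<dots> = complex_of_real (kippenhahn (c + f + g) (f * g + c * (f + g)) (c * f * g) u t)"
    unfolding of_real_kippenhahn T_def[symmetric] complex_cnj_add complex_cnj_mult complex_cnj_diff cc
    using uu[unfolded cc] by algebra
  finally show ?thesis unfolding of_real_eq_iff by simp
qed

text \<open>The directions 1, \<open>\<i>\<close> and \<open>(3 \<plusminus> 4 \<i>) / 5\<close> already determine both coefficients.\<close>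

lemma Re_cubic_trig_eq_0:
  assumes "\<And>u. cmod u = 1 \<Longrightarrow> Re (cnj u ^ 3 * p + cnj u * q) = 0"
  shows "p = 0" "q = 0"
proof -
  have c: "cmod (Complex (3/5) (4/5)) = 1" "cmod (Complex (3/5) (-4/5)) = 1"
    by (simp_all add: unimodular_Re_Im power2_eq_square)
  have "Re p = 0 \<and> Im p = 0 \<and> Re q = 0 \<and> Im q = 0"
    using assms[of 1] assms[of \<i>] assms[OF c(1)] assms[OF c(2)]
    by (simp add: power3_eq_cube)
  then show "p = 0" "q = 0" by (simp_all add: complex_eq_iff)
qed

lemma Re_quadratic_trig_eq_0:
  assumes "\<And>u. cmod u = 1 \<Longrightarrow> Re (cnj u ^ 2 * p) + r = 0"
  shows "p = 0" "r = 0"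
proof -
  have c: "cmod (Complex (3/5) (4/5)) = 1"
    by (simp_all add: unimodular_Re_Im power2_eq_square)
  have "Re p = 0 \<and> Im p = 0 \<and> r = 0"
    using assms[of 1] assms[of \<i>] assms[OF c]
    by (simp add: power2_eq_square)
  then show "p = 0" "r = 0" by (simp_all add: complex_eq_iff)
qed

lemma kippenhahn_uminus: "kippenhahn \<tau> \<sigma> \<delta> (- u) t = - kippenhahn \<tau> \<sigma> \<delta> u (- t)"
  by (simp add: kippenhahn_def algebra_simps power2_eq_square power3_eq_cube)

lemma cubic_two_roots:
  fixes r1 r2 :: real
  assumes "r1 \<noteq> r2" "r1^3 - e1 * r1^2 + e2 * r1 - e3 = 0" "r2^3 - e1 * r2^2 + e2 * r2 - e3 = 0"
  shows "e2 = r1 * r2 + (e1 - r1 - r2) * (r1 + r2)" "e3 = (e1 - r1 - r2) * (r1 * r2)"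
proof -
  have "(r1 - r2) * (e2 - (r1 * r2 + (e1 - r1 - r2) * (r1 + r2))) = 0"
    using assms(2,3) by algebra
  then show "e2 = r1 * r2 + (e1 - r1 - r2) * (r1 + r2)" using assms(1) by simp
  then show "e3 = (e1 - r1 - r2) * (r1 * r2)" using assms(2) by algebra
qed

text \<open>The larger root of the quadratic for \<open>- u\<close> is minus the smaller one for \<open>u\<close>, so the cubic vanishes at both
  roots of the quadratic and is divisible by it. Subtracting these roots from the sum
  \<open>2 Re (cnj u * \<tau>)\<close> of all three leaves the third root \<open>2 Re (cnj u * c)\<close>; comparing trigonometric coefficients gives the relations.\<close>

lemma focal_relation:
  assumes D: "0 < D"
    and roots: "\<And>u. cmod u = 1 \<Longrightarrow> kippenhahn \<tau> \<sigma> \<delta> u (ellipse_top f g D u) = 0"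
  defines "c \<equiv> \<tau> - f - g"
  shows "\<sigma> = f * g + c * (f + g)" "\<delta> = c * f * g"
    "(1 - c * cnj c) * focal_defect c f g = 0"
proof -
  define \<kappa> where "\<kappa> = \<sigma> * cnj \<tau> - \<tau> - \<delta> * cnj \<sigma>"
  have coeffs:
    "2 * Re (cnj u ^ 2 * \<sigma>) + (cmod \<tau>)\<^sup>2 - 2 - (cmod \<delta>)\<^sup>2 =
      (2 * Re (cnj u ^ 2 * (f * g)) + 2 * Re (f * cnj g) - D)
        + 2 * Re (cnj u * c) * (2 * Re (cnj u * (f + g)))"
    "2 * Re (cnj u ^ 3 * \<delta> + cnj u * \<kappa>) =
      2 * Re (cnj u * c) * (2 * Re (cnj u ^ 2 * (f * g)) + 2 * Re (f * cnj g) - D)"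
    if u: "cmod u = 1" for u
  proof -
    define r1 r2 where "r1 = ellipse_top f g D u" and "r2 = - ellipse_top f g D (- u)"
    have "r1 \<noteq> r2" unfolding r1_def r2_def using ellipse_quad_factor(2)[OF D, of f g u] by simp
    moreover have "kippenhahn \<tau> \<sigma> \<delta> u r1 = 0" unfolding r1_def by (rule roots[OF u])
    moreover have "kippenhahn \<tau> \<sigma> \<delta> u r2 = 0"
      using roots[of "- u"] u unfolding r2_def by (simp add: kippenhahn_uminus)
    ultimately have *: "2 * Re (cnj u ^ 2 * \<sigma>) + (cmod \<tau>)\<^sup>2 - 2 - (cmod \<delta>)\<^sup>2 =
        r1 * r2 + (2 * Re (cnj u * \<tau>) - r1 - r2) * (r1 + r2)"
      "2 * Re (cnj u ^ 3 * \<delta> + cnj u * \<kappa>) = (2 * Re (cnj u * \<tau>) - r1 - r2) * (r1 * r2)"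
      unfolding kippenhahn_def \<kappa>_def[symmetric] by (rule cubic_two_roots)+
    have sum: "r1 + r2 = 2 * Re (cnj u * (f + g))"
      unfolding r1_def r2_def ellipse_top_def by (simp add: power2_eq_square algebra_simps)
    have "- (r1 * - r2) = ellipse_quad f g D u 0"
      unfolding ellipse_quad_factor(1)[OF D] r1_def r2_def by simp
    also have "\<dots> = 2 * Re (cnj u ^ 2 * (f * g)) + 2 * Re (f * cnj g) - D"
    proof -
      have "(0 - 2 * X) * (0 - 2 * Y) - D = 4 * X * Y - D" for X Y :: real by simp
      then show ?thesis
        using Re_product_rotated[OF u, of f g] unfolding ellipse_quad_def complex_cnj_power by metis
    qed
    finally have prod: "r1 * r2 = 2 * Re (cnj u ^ 2 * (f * g)) + 2 * Re (f * cnj g) - D" by simp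
    have diff: "2 * Re (cnj u * \<tau>) - r1 - r2 = 2 * Re (cnj u * c)"
      using sum by (simp add: c_def algebra_simps)
    show "2 * Re (cnj u ^ 2 * \<sigma>) + (cmod \<tau>)\<^sup>2 - 2 - (cmod \<delta>)\<^sup>2 =
      (2 * Re (cnj u ^ 2 * (f * g)) + 2 * Re (f * cnj g) - D)
        + 2 * Re (cnj u * c) * (2 * Re (cnj u * (f + g)))"
      using *(1) unfolding diff sum prod .
    show "2 * Re (cnj u ^ 3 * \<delta> + cnj u * \<kappa>) =
      2 * Re (cnj u * c) * (2 * Re (cnj u ^ 2 * (f * g)) + 2 * Re (f * cnj g) - D)"
      using *(2) unfolding diff prod .
  qed
  have "Re (cnj u ^ 2 * (\<sigma> - (f * g + c * (f + g)))) + ((cmod \<tau>)\<^sup>2 - 2 - (cmod \<delta>)\<^sup>2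
      - 2 * Re (f * cnj g) + D - 2 * Re (c * cnj (f + g))) / 2 = 0" if u: "cmod u = 1" for u
  proof -
    have "Re (w * (x - (y + z))) = Re (w * x) - Re (w * y) - Re (w * z)" for w x y z :: complex
      by (simp add: algebra_simps)
    moreover have "S - P - X + (T - 2 - E - 2 * R + D - 2 * Y) / 2 = 0"
      if "2 * S + T - 2 - E = (2 * P + 2 * R - D) + 2 * a * (2 * b)" "4 * a * b = 2 * X + 2 * Y"
      for S P X T E R Y a b :: real
      using that by (simp add: field_simps)
    ultimately show ?thesis
      using coeffs(1)[OF u] Re_product_rotated[OF u, of c "f + g"] unfolding complex_cnj_power by presburger
  qed
  note trig = Re_quadratic_trig_eq_0[OF this]
  from trig(1) show \<sigma>: "\<sigma> = f * g + c * (f + g)" by simp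
  from trig(2) have D_eq: "D = 2 + (cmod \<delta>)\<^sup>2 + 2 * Re (f * cnj g) + 2 * Re (c * cnj (f + g)) - (cmod \<tau>)\<^sup>2"
    by simp
  have "Re (cnj u ^ 3 * (\<delta> - c * f * g) + cnj u * (\<kappa> - cnj c * f * g - of_real (2 * Re (f * cnj g) - D) * c)) = 0"
    if u: "cmod u = 1" for u
  proof -
    have "u * cnj u = 1" using u complex_norm_square[of u] by simp
    then have "cnj u ^ 2 * cnj (cnj u) = cnj u"
      by (simp add: power2_eq_square mult.assoc mult.commute)
    then have "cnj u ^ 3 * (c * f * g) + cnj u * (cnj c * f * g) = cnj u ^ 2 * (f * g) * (cnj u * c + cnj (cnj u * c))"
      by (simp add: algebra_simps power2_eq_square power3_eq_cube)
    also have "\<dots> = of_real (2 * Re (cnj u * c)) * (cnj u ^ 2 * (f * g))"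
      by (simp only: complex_add_cnj mult.commute)
    finally have "Re (cnj u ^ 3 * (c * f * g) + cnj u * (cnj c * f * g)) = 2 * Re (cnj u * c) * Re (cnj u ^ 2 * (f * g))"
      by simp
    moreover have "Re (cnj u ^ 3 * (\<delta> - c * f * g) + cnj u * (\<kappa> - cnj c * f * g - of_real (2 * Re (f * cnj g) - D) * c))
       = Re (cnj u ^ 3 * \<delta> + cnj u * \<kappa>) - Re (cnj u ^ 3 * (c * f * g) + cnj u * (cnj c * f * g))
         - (2 * Re (f * cnj g) - D) * Re (cnj u * c)"
      by (simp add: algebra_simps)
    ultimately show ?thesis using coeffs(2)[OF u] by (simp add: algebra_simps)
  qed
  from Re_cubic_trig_eq_0(1)[OF this] show \<delta>: "\<delta> = c * f * g" by simp
  have \<tau>: "\<tau> = c + f + g" by (simp add: c_def)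
  have "D = focal_constant c f g"
    unfolding D_eq focal_constant_def \<delta> \<tau> cmod_power2[of "c + f + g"] cmod_power2[of c] cmod_power2[of f] cmod_power2[of g]
    by (simp add: power2_eq_square algebra_simps)
  then have "Re (cnj u ^ 3 * 0 + cnj u * ((1 - c * cnj c) * focal_defect c f g)) = 0" if "cmod u = 1" for u
    using kippenhahn_factor[OF that, of c f g "ellipse_top f g D u"] roots[OF that] 
      ellipse_quad_factor(1)[OF D, of f g u "ellipse_top f g D u"]
    unfolding \<sigma> \<delta> \<tau> by simp
  from Re_cubic_trig_eq_0(2)[OF this] show "(1 - c * cnj c) * focal_defect c f g = 0" .
qed

text \<open>Put \<open>x = cnj a - f\<close> and \<open>y = cnj a - g\<close>. Then \<open>x * y\<close> is the value of \<open>\<Phi>\<^sub>2\<close> at \<open>cnj a\<close>, which is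
  \<open>- cnj b (1 - |a|\<^sup>2)\<close>, and the sum of the distances from \<open>cnj a\<close> to the foci falls short of \<open>s\<close> because
  \<open>s\<^sup>2 = (|x| + |y|)\<^sup>2 + 2 (1 - |a|\<^sup>2) (1 - |b|)\<close>.\<close>

lemma szego_roots_ellipse:
  assumes ab: "cmod a < 1" "cmod b < 1"
    and fg: "f + g = cnj a - a * cnj b" "f * g = - cnj b"
  shows "\<exists>s. dist f g < s \<and> dist (cnj a) f + dist (cnj a) g < s \<and>
      focal_constant (cnj a) f g = s\<^sup>2 - (dist f g)\<^sup>2" and "focal_defect (cnj a) f g = 0"
proof -
  show "focal_defect (cnj a) f g = 0"
    unfolding focal_defect_def fg by (simp add: algebra_simps)
  define x y where "x = cnj a - f" and "y = cnj a - g"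
  have "x * y = (cnj a)\<^sup>2 - cnj a * (f + g) + f * g"
    by (simp add: x_def y_def power2_eq_square algebra_simps)
  also have "\<dots> = - (cnj b * (1 - a * cnj a))"
    unfolding fg by (simp add: power2_eq_square algebra_simps)
  also have "1 - a * cnj a = of_real (1 - (cmod a)\<^sup>2)"
    unfolding of_real_diff complex_norm_square by simp
  finally have "cmod (x * y) = cmod b * \<bar>1 - (cmod a)\<^sup>2\<bar>"
    by (simp only: norm_minus_cancel norm_mult norm_of_real complex_mod_cnj)
  moreover have a2: "(cmod a)\<^sup>2 < 1" using ab by (simp add: abs_square_less_1)
  ultimately have xy: "cmod (x * y) = cmod b * (1 - (cmod a)\<^sup>2)" by simp
  have "cnj (f + g) = a - cnj a * b" unfolding fg by simp
  have "2 * Re (x * cnj y) = (cmod a)\<^sup>2 * (1 + (cmod b)\<^sup>2) - (cmod f)\<^sup>2 - (cmod g)\<^sup>2"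
  proof -
    have "complex_of_real (2 * Re (x * cnj y)) = x * cnj y + cnj x * y"
      by (simp add: complex_eq_iff)
    also have "\<dots> = 2 * (a * cnj a) - a * (f + g) - cnj a * cnj (f + g) + (f + g) * cnj (f + g) - f * cnj f - g * cnj g"
      by (simp add: x_def y_def algebra_simps)
    also have "\<dots> = (a * cnj a) * (1 + b * cnj b) - f * cnj f - g * cnj g"
      unfolding fg by (simp add: algebra_simps)
    also have "\<dots> = of_real ((cmod a)\<^sup>2 * (1 + (cmod b)\<^sup>2) - (cmod f)\<^sup>2 - (cmod g)\<^sup>2)"
      unfolding of_real_diff of_real_mult of_real_add complex_norm_square by simp
    finally show ?thesis unfolding of_real_eq_iff .
  qed
  moreover have "cnj a * f * g = cnj a * - cnj b" using fg(2) by (simp add: mult.assoc)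
  then have "cmod (cnj a * f * g) = cmod a * cmod b" by (simp add: norm_mult)
  ultimately have "focal_constant (cnj a) f g + (cmod (x - y))\<^sup>2 =
      (cmod x + cmod y)\<^sup>2 + 2 * (1 - (cmod a)\<^sup>2) * (1 - cmod b)"
    using focal_identity[of x y] xy
    by (simp add: focal_constant_def power_mult_distrib algebra_simps)
  moreover have "0 < 2 * (1 - (cmod a)\<^sup>2) * (1 - cmod b)" using a2 ab by simp
  ultimately have less: "(cmod x + cmod y)\<^sup>2 < focal_constant (cnj a) f g + (cmod (x - y))\<^sup>2" by linarith
  define s where "s = sqrt (focal_constant (cnj a) f g + (cmod (x - y))\<^sup>2)"
  have s: "cmod x + cmod y < s" unfolding s_def using less by (rule real_less_rsqrt)
  have dxy: "cmod (x - y) = dist f g" by (simp add: x_def y_def dist_norm norm_minus_commute)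
  have "0 \<le> focal_constant (cnj a) f g + (cmod (x - y))\<^sup>2" using less by (meson less_imp_le order_trans zero_le_power2)
  then have "focal_constant (cnj a) f g = s\<^sup>2 - (dist f g)\<^sup>2" by (simp add: s_def dxy)
  moreover have "dist f g < s" using s norm_triangle_ineq4[of x y] dxy by linarith
  moreover have "dist (cnj a) f + dist (cnj a) g < s" using s by (simp add: x_def y_def dist_norm)
  ultimately show "\<exists>s. dist f g < s \<and> dist (cnj a) f + dist (cnj a) g < s \<and>
      focal_constant (cnj a) f g = s\<^sup>2 - (dist f g)\<^sup>2" by blast
qed

lemma support_attained:
  assumes "compact W" "W \<noteq> {}"
  shows "\<exists>w\<in>W. \<forall>z\<in>W. 2 * Re (cnj u * z) \<le> 2 * Re (cnj u * w)"
  using assms by (intro continuous_attains_sup continuous_intros)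

lemma charpoly_3_linear_factors:
  fixes A :: "complex^3^3"
  assumes "charpoly A = [:- c, 1:] * ([:- f, 1:] * [:- g, 1:])"
  shows "trace A = c + f + g" "minor_sum A = f * g + c * (f + g)" "det A = c * f * g"
  using assms unfolding charpoly_3 by (simp_all add: algebra_simps)

text \<open>For each \<open>u\<close> the determinant has the roots \<open>2 Re (cnj u * cnj a)\<close>, \<open>T u\<close> and \<open>- T (- u)\<close>, of which \<open>T u\<close> is
  the largest; so \<open>W(A)\<close> and the elliptical disk have the same tangents.\<close>

theorem numerical_range_of_szego_product:
  fixes A :: "complex^3^3"
  assumes rank: "rank (mat 1 - A ** cadjoint A) = 1"
    and ab: "cmod a < 1" "cmod b < 1"
    and fg: "f + g = cnj a - a * cnj b" "f * g = - cnj b"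
    and char: "charpoly A = [:- cnj a, 1:] * ([:- f, 1:] * [:- g, 1:])"
  shows "ellipse_with_foci (frontier (numerical_range A)) f g"
proof -
  obtain s where s: "dist f g < s" "dist (cnj a) f + dist (cnj a) g < s"
    and D: "focal_constant (cnj a) f g = s\<^sup>2 - (dist f g)\<^sup>2"
    using szego_roots_ellipse(1)[OF ab fg] by blast
  define T where "T = ellipse_top f g (s\<^sup>2 - (dist f g)\<^sup>2)"
  have "0 < s" using s(1) zero_le_dist[of f g] by linarith
  then have D0: "0 < s\<^sup>2 - (dist f g)\<^sup>2" using s(1) by (simp add: power_strict_mono)
  note K = charpoly_3_linear_factors[OF char]
  have det: "det (mat (of_real t) - rotated_sum u A) = 0 \<longleftrightarrow>
      t = 2 * Re (cnj u * cnj a) \<or> t = T u \<or> t = - T (- u)" if u: "cmod u = 1" for u t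
  proof -
    have "det (mat (of_real t) - rotated_sum u A) =
        of_real ((t - 2 * Re (cnj u * cnj a)) * ((t - T u) * (t + T (- u))))"
      unfolding det_rotated_sum[OF rank u] K kippenhahn_factor[OF u] szego_roots_ellipse(2)[OF ab fg] D
        ellipse_quad_factor(1)[OF D0] T_def by simp
    then show ?thesis by (simp only: of_real_eq_0_iff mult_eq_0_iff) auto
  qed
  have attained: "\<exists>w\<in>numerical_range A. 2 * Re (cnj u * w) = T u" if u: "cmod u = 1" for u
    by (rule det_zero_attained) (simp add: det[OF u])
  have "2 * Re (cnj u * w) \<le> T u" if u: "cmod u = 1" and w: "w \<in> numerical_range A" for u w
  proof -
    obtain w0 where w0: "w0 \<in> numerical_range A"
      "\<And>z. z \<in> numerical_range A \<Longrightarrow> 2 * Re (cnj u * z) \<le> 2 * Re (cnj u * w0)"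
      using support_attained[OF compact_numerical_range numerical_range_nonempty] by meson
    define t where "t = 2 * Re (cnj u * w0)"
    have "det (mat (of_real t) - rotated_sum u A) = 0"
      using det_zero_at_support[of A u t w0] w0 by (simp add: t_def)
    moreover have "T u \<le> t" using attained[OF u] w0(2) unfolding t_def by force
    moreover have "2 * Re (cnj u * cnj a) < T u"
      unfolding T_def by (rule ellipse_interior_point_quad[OF s u])
    moreover have "- T (- u) < T u" unfolding T_def by (rule ellipse_quad_factor(2)[OF D0])
    ultimately have "t = T u" unfolding det[OF u] by linarith
    then show ?thesis using w0(2)[OF w] by (simp add: t_def)
  qed
  then have "numerical_range A = {z. dist z f + dist z g \<le> s}"
    using attained unfolding T_def
    by (intro convex_compact_eq_ellipse_disk compact_numerical_range convex_numerical_range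
        numerical_range_nonempty s)
  then show ?thesis
    unfolding ellipse_with_foci_def using frontier_ellipse_disk[OF s(1)] s(1) by auto
qed

lemma support_on_frontier:
  fixes W :: "complex set"
  assumes u: "cmod u = 1" and w: "w \<in> W" "\<And>z. z \<in> W \<Longrightarrow> 2 * Re (cnj u * z) \<le> 2 * Re (cnj u * w)"
  shows "w \<in> frontier W"
proof -
  have "w \<notin> interior W"
  proof
    assume "w \<in> interior W"
    then obtain e where e: "e > 0" "ball w e \<subseteq> W" by (auto simp: mem_interior)
    define z where "z = w + of_real (e / 2) * u"
    have "dist w z = e / 2" using u e(1) by (simp add: z_def dist_norm norm_mult)
    then have "z \<in> W" using e by auto
    moreover have "cnj u * z = cnj u * w + of_real (e / 2)"
      using u complex_norm_square[of u] by (simp add: z_def algebra_simps)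
    ultimately show False using w(2)[of z] e(1) by simp
  qed
  then show ?thesis using w(1) closure_subset unfolding frontier_def by blast
qed

lemma charpoly_root_norm_less_1:
  fixes A :: "complex^3^3"
  assumes A: "A \<in> S_class" and root: "poly (charpoly A) c = 0"
  shows "cmod c < 1"
proof -
  have "poly (charpoly A) c = det (mat c - A)"
    by (simp add: charpoly_3 det_3 trace_def sum_3 minor_sum_def mat_def) algebra
  then obtain x where x: "x \<noteq> 0" "(mat c - A) *v x = 0"
    using root det_eq_0_iff_kernel by metis
  have "mat c *v x = c *s x"
    by (simp add: vec_eq_iff matrix_vector_mult_def mat_def if_distrib[of "\<lambda>a. a * _"] cong: if_cong)
  then have "A *v x = c *s x" using x(2) by (simp add: matrix_vector_mult_diff_rdistrib)
  then show ?thesis using A x(1) unfolding S_class_def by blast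
qed

text \<open>The eigenvalues lie in the open disk, so the factor \<open>1 - |c|\<^sup>2\<close> cancels from the relation in \<open>focal_relation\<close>.
  Together with its conjugate, what remains is a linear system for \<open>f + g\<close> in terms of \<open>c\<close> and \<open>f g\<close>.\<close>

theorem charpoly_of_elliptical_numerical_range:
  fixes A :: "complex^3^3"
  assumes A: "A \<in> S_class" and E: "ellipse_with_foci (frontier (numerical_range A)) f g"
  shows "\<exists>a b. cmod a < 1 \<and> cmod b < 1 \<and> f + g = cnj a - a * cnj b \<and> f * g = - cnj b \<and>
      charpoly A = [:- cnj a, 1:] * ([:- f, 1:] * [:- g, 1:])"
proof -
  have rank: "rank (mat 1 - A ** cadjoint A) = 1" using A by (simp add: S_class_def)
  obtain s where s: "dist f g < s" and front: "frontier (numerical_range A) = {z. dist z f + dist z g = s}"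
    using E unfolding ellipse_with_foci_def by blast
  define D where "D = s\<^sup>2 - (dist f g)\<^sup>2"
  have "0 < s" using s zero_le_dist[of f g] by linarith
  then have D: "0 < D" unfolding D_def using s by (simp add: power_strict_mono)
  have "frontier (numerical_range A) \<subseteq> numerical_range A"
    using compact_imp_closed[OF compact_numerical_range] by (rule frontier_subset_closed)
  then have sub: "{z. dist z f + dist z g = s} \<subseteq> numerical_range A" unfolding front .
  have roots: "kippenhahn (trace A) (minor_sum A) (det A) u (ellipse_top f g D u) = 0"
    if u: "cmod u = 1" for u
  proof -
    obtain z where z: "dist z f + dist z g = s" "2 * Re (cnj u * z) = ellipse_top f g D u"
      using ellipse_tangent_point[OF u s] unfolding D_def by blast
    obtain w0 where w0: "w0 \<in> numerical_range A"
      "\<And>z. z \<in> numerical_range A \<Longrightarrow> 2 * Re (cnj u * z) \<le> 2 * Re (cnj u * w0)"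
      using support_attained[OF compact_numerical_range numerical_range_nonempty] by meson
    have "dist w0 f + dist w0 g = s" using support_on_frontier[OF u w0] front by auto
    then have "ellipse_quad f g D u (2 * Re (cnj u * w0)) \<le> 0"
      using ellipse_quad_le[OF u, of f g s w0] unfolding D_def by simp
    then have "2 * Re (cnj u * w0) \<le> ellipse_top f g D u"
      unfolding ellipse_quad_factor(1)[OF D] mult_le_0_iff
      using ellipse_quad_factor(2)[OF D, of f g u] by linarith
    then have "det (mat (of_real (ellipse_top f g D u)) - rotated_sum u A) = 0"
      using sub z w0(2) by (intro det_zero_at_support[of A u _ z]) (auto intro: order_trans)
    then show ?thesis unfolding det_rotated_sum[OF rank u] by simp
  qed
  define c where "c = trace A - f - g"
  have rel: "minor_sum A = f * g + c * (f + g)" "det A = c * f * g"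
    "(1 - c * cnj c) * focal_defect c f g = 0"
    unfolding c_def by (rule focal_relation[OF D roots]; assumption)+
  have char: "charpoly A = [:- c, 1:] * ([:- f, 1:] * [:- g, 1:])"
    unfolding charpoly_3 rel by (simp add: c_def algebra_simps)
  have root: "cmod c < 1" "cmod f < 1" "cmod g < 1"
  proof -
    have "poly (charpoly A) x = (x - c) * ((x - f) * (x - g))" for x
      unfolding char by (simp add: algebra_simps)
    then show "cmod c < 1" "cmod f < 1" "cmod g < 1"
      using charpoly_root_norm_less_1[OF A] by simp_all
  qed
  have "1 - c * cnj c \<noteq> 0"
  proof
    assume "1 - c * cnj c = 0"
    then have "complex_of_real ((cmod c)\<^sup>2) = of_real 1" unfolding complex_norm_square by simp
    then have "(cmod c)\<^sup>2 = 1" unfolding of_real_eq_iff .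
    then show False using root(1) norm_ge_zero[of c] by (auto simp only: power2_eq_1_iff)
  qed
  then have defect: "focal_defect c f g = 0" using rel(3) by simp
  have fg1: "cmod (f * g) < 1" using mult_strict_mono'[OF root(2,3)] by (simp add: norm_mult)
  have fg0: "1 - (f * g) * cnj (f * g) \<noteq> 0"
  proof
    assume "1 - (f * g) * cnj (f * g) = 0"
    then have "complex_of_real ((cmod (f * g))\<^sup>2) = of_real 1" unfolding complex_norm_square by simp
    then have "(cmod (f * g))\<^sup>2 = 1" unfolding of_real_eq_iff .
    then show False using fg1 norm_ge_zero[of "f * g"] by (auto simp only: power2_eq_1_iff)
  qed
  define p q where "p = f * g" and "q = f + g"
  have "c * (1 - p * cnj p) = q - p * cnj q"
    using defect unfolding focal_defect_def p_def q_def by (simp add: algebra_simps)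
  moreover from arg_cong[OF this, of cnj] have "cnj c * (1 - p * cnj p) = cnj q - cnj p * q"
    by (simp add: mult.commute)
  ultimately have "(c + cnj c * p) * (1 - p * cnj p) = q * (1 - p * cnj p)"
    by algebra
  then have "q = c + cnj c * p" using fg0 unfolding p_def by simp
  then have "f + g = cnj (cnj c) - cnj c * cnj (- cnj (f * g))" "f * g = - cnj (- cnj (f * g))"
    by (simp_all add: p_def q_def)
  moreover have "charpoly A = [:- cnj (cnj c), 1:] * ([:- f, 1:] * [:- g, 1:])" using char by simp
  moreover have "cmod (cnj c) < 1" "cmod (- cnj (f * g)) < 1" using root fg1 by (simp_all only: norm_minus_cancel complex_mod_cnj)
  ultimately show ?thesis by blast
qed

section \<open>Chords of the unit circle through a fixed point\<close>

text \<open>The other end of the chord through \<open>z\<close> and \<open>cnj a\<close>, for \<open>z\<close> on the unit circle. The product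
  \<open>z * chord_partner a z\<close> is \<open>- z (z - cnj a) / (1 - a z)\<close>, the negative of a Blaschke product of degree 2.\<close>

definition chord_partner :: "complex \<Rightarrow> complex \<Rightarrow> complex" where
  "chord_partner a z = (cnj a - z) / (1 - a * z)"

lemma unimodular_mult_cnj: "cmod z = 1 \<longleftrightarrow> z * cnj z = 1"
proof -
  have "z * cnj z = of_real ((cmod z)\<^sup>2)" by (simp only: complex_norm_square)
  also have "\<dots> = 1 \<longleftrightarrow> (cmod z)\<^sup>2 = 1" by (metis of_real_1 of_real_eq_iff)
  also have "\<dots> \<longleftrightarrow> cmod z = 1" by (simp add: abs_square_eq_1)
  finally show ?thesis by simp
qed

context
  fixes a :: complex
  assumes a: "cmod a < 1"
begin

lemma one_minus_nonzero: "cmod z = 1 \<Longrightarrow> 1 - a * z \<noteq> 0"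
  using a by (metis eq_iff_diff_eq_0 less_irrefl mult.right_neutral norm_mult norm_one)

lemma partner_sum:
  assumes "cmod z = 1"
  shows "z + chord_partner a z = cnj a + a * (z * chord_partner a z)"
  using one_minus_nonzero[OF assms] by (simp add: chord_partner_def field_simps)

lemma partner_unique:
  assumes "cmod z = 1" "z + w = cnj a + a * (z * w)"
  shows "w = chord_partner a z"
proof -
  have "w * (1 - a * z) = cnj a - z" using assms(2) by (simp add: algebra_simps eq_diff_eq)
  then show ?thesis using one_minus_nonzero[OF assms(1)] by (simp add: chord_partner_def eq_divide_eq)
qed

lemma norm_partner:
  assumes "cmod z = 1"
  shows "cmod (chord_partner a z) = 1"
proof -
  have z: "z * cnj z = 1" using assms unimodular_mult_cnj by blast
  have "cnj a - z = - (z * cnj (1 - a * z))" using z by (simp add: algebra_simps)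
  then have "cmod (cnj a - z) = cmod (1 - a * z)"
    using assms by (simp only: norm_minus_cancel norm_mult complex_mod_cnj mult_1)
  then show ?thesis using one_minus_nonzero[OF assms] by (simp add: chord_partner_def norm_divide)
qed

lemma partner_partner:
  assumes "cmod z = 1"
  shows "chord_partner a (chord_partner a z) = z"
  using partner_unique[OF norm_partner[OF assms], of z] partner_sum[OF assms]
  by (simp add: add.commute mult.commute)

lemma partner_neq:
  assumes "cmod z = 1"
  shows "chord_partner a z \<noteq> z"
proof
  assume "chord_partner a z = z"
  then have *: "2 * z = cnj a + a * (z * z)" using partner_sum[OF assms] by simp
  have "2 = cmod (cnj a + a * (z * z))" using arg_cong[OF *, of cmod] assms by (simp add: norm_mult)
  also have "\<dots> \<le> cmod a + cmod a"
    using norm_triangle_ineq[of "cnj a" "a * (z * z)"] assms by (simp add: norm_mult)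
  finally show False using a by simp
qed

lemma partner_product_eq:
  assumes "cmod z = 1" "cmod w = 1" "z * chord_partner a z = w * chord_partner a w"
  shows "w = z \<or> w = chord_partner a z"
proof -
  have "z + chord_partner a z = w + chord_partner a w"
    using partner_sum[OF assms(1)] partner_sum[OF assms(2)] assms(3) by simp
  then have "(w - z) * (w - chord_partner a z) = 0" using assms(3) by algebra
  then show ?thesis by auto
qed

text \<open>The points of the circle at which the Blaschke product takes its value at \<open>z\<close> are \<open>z\<close> and its partner.\<close>

lemma partner_quadratic:
  assumes "cmod z = 1"
  shows "x * (x - cnj a) + z * chord_partner a z * (1 - a * x) = (x - z) * (x - chord_partner a z)"
  using partner_sum[OF assms] by algebra

end

lemma complex_quadratic_roots: "\<exists>f g. f + g = p \<and> f * g = (q::complex)"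
proof -
  define d where "d = csqrt (p\<^sup>2 - 4 * q)"
  have "d\<^sup>2 = p\<^sup>2 - 4 * q" by (simp add: d_def)
  then have "(p + d) / 2 * ((p - d) / 2) = q" by (simp add: field_simps power2_eq_square)
  moreover have "(p + d) / 2 + (p - d) / 2 = p" by (simp add: field_simps)
  ultimately show ?thesis by blast
qed

text \<open>A root of the quadratic for the value \<open>m\<close> lies on the circle: if \<open>n = |w|\<^sup>2\<close>, taking absolute values in the
  equation gives \<open>(n - 1) (|w - cnj a|\<^sup>2 + 1 - |a|\<^sup>2) = 0\<close>.\<close>

lemma partner_product_surj:
  assumes a: "cmod a < 1" and m: "cmod m = 1"
  shows "\<exists>w. cmod w = 1 \<and> w * chord_partner a w = m"
proof -
  obtain w v where wv: "w + v = cnj a + a * m" "w * v = m"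
    using complex_quadratic_roots by blast
  have eq: "w * (w - cnj a) = - (m * (1 - a * w))"
    using wv by algebra
  define n k where "n = (cmod w)\<^sup>2" and "k = (cmod (w - cnj a))\<^sup>2"
  have "(cmod (1 - a * w))\<^sup>2 = k + (1 - (cmod a)\<^sup>2) * (1 - n)"
    unfolding n_def k_def cmod_power2 by (simp add: power2_eq_square algebra_simps)
  moreover have "n * k = (cmod (1 - a * w))\<^sup>2"
    using arg_cong[OF eq, of "\<lambda>x. (cmod x)\<^sup>2"] m by (simp add: n_def k_def norm_mult power_mult_distrib)
  ultimately have "(n - 1) * (k + (1 - (cmod a)\<^sup>2)) = 0" by algebra
  moreover have "0 < k + (1 - (cmod a)\<^sup>2)"
    using a by (simp add: k_def add_nonneg_pos abs_square_less_1)
  ultimately have "n = 1" by simp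
  then have w: "cmod w = 1" unfolding n_def using norm_ge_zero[of w] by (auto simp: power2_eq_1_iff)
  have "w + v = cnj a + a * (w * v)" using wv by simp
  then have "v = chord_partner a w" by (rule partner_unique[OF a w])
  then show ?thesis using w wv(2) by blast
qed

lemma chord_line_unimodular:
  assumes "cmod z = 1" "cmod w = 1" "z \<noteq> w"
  shows "p \<in> chord_line (z, w) \<longleftrightarrow> p + z * w * cnj p = z + w"
proof -
  have zw: "z * cnj z = 1" "w * cnj w = 1" using assms unimodular_mult_cnj by auto
  have "p \<in> chord_line (z, w) \<longleftrightarrow> (\<exists>k::real. p = z + of_real k * (w - z))"
  proof -
    have "of_real x * z + of_real y * w = z + of_real y * (w - z)" if "x + y = 1" for x y :: real
    proof -
      have "x = 1 - y" using that by simp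
      then show ?thesis by (simp only: of_real_diff of_real_1) (simp add: algebra_simps)
    qed
    then have "(\<exists>x y. p = of_real x * z + of_real y * w \<and> x + y = 1) \<longleftrightarrow>
        (\<exists>k::real. p = z + of_real k * (w - z))"
      by (metis diff_add_cancel)
    then show ?thesis
      unfolding chord_line_def affine_hull_2 by (simp add: scaleR_conv_of_real)
  qed
  also have "\<dots> \<longleftrightarrow> p + z * w * cnj p = z + w"
  proof
    assume "\<exists>k::real. p = z + of_real k * (w - z)"
    then obtain k :: real where k: "p = z + of_real k * (w - z)" by blast
    then have k': "cnj p = cnj z + of_real k * (cnj w - cnj z)" by simp
    show "p + z * w * cnj p = z + w" unfolding k' unfolding k using zw by algebra
  next
    assume p: "p + z * w * cnj p = z + w"
    define k where "k = (p - z) / (w - z)"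
    have pk: "p = z + k * (w - z)" using assms(3) by (simp add: k_def)
    have pk': "cnj p = cnj z + cnj k * (cnj w - cnj z)" unfolding pk by simp
    have "(w - z) * (k - cnj k) = 0" using p zw unfolding pk' unfolding pk by algebra
    then have "k = cnj k" using assms(3) by simp
    then have "k = of_real (Re k)" by (simp add: complex_eq_iff)
    then show "\<exists>k::real. p = z + of_real k * (w - z)" using pk by metis
  qed
  finally show ?thesis .
qed

text \<open>In this form the line depends on its ends only through their product, and \<open>cnj a\<close> is visibly on it.\<close>

lemma chord_line_partner:
  assumes "cmod a < 1" "cmod z = 1"
  shows "p \<in> chord_line (z, chord_partner a z) \<longleftrightarrow>
    p - cnj a = - (z * chord_partner a z) * cnj (p - cnj a)"
  using chord_line_unimodular[OF assms(2) norm_partner[OF assms] partner_neq[OF assms, symmetric], of p]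
    partner_sum[OF assms]
  by (auto simp: algebra_simps)

section \<open>Cyclic order\<close>

text \<open>If both ends of the second chord lie strictly on the same side of the first, so does every point between
  them, and the common point \<open>c\<close>, being inside the disk, lies between the ends. The product of sines
  is the signed distance from the first chord, up to a factor.\<close>

lemma chords_through_point_cross:
  assumes c: "cmod c < 1" and gd: "cis \<gamma> \<noteq> cis \<delta>"
    and ab: "c + cis \<alpha> * cis \<beta> * cnj c = cis \<alpha> + cis \<beta>"
    and "c + cis \<gamma> * cis \<delta> * cnj c = cis \<gamma> + cis \<delta>"
    and side: "0 < sin ((\<gamma> - \<alpha>) / 2) * sin ((\<gamma> - \<beta>) / 2)"
      "0 < sin ((\<delta> - \<alpha>) / 2) * sin ((\<delta> - \<beta>) / 2)"
  shows False
proof -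
  define m where "m = (\<alpha> + \<beta>) / 2"
  define F where "F z = Re (z * cis (- m)) - cos ((\<beta> - \<alpha>) / 2)" for z
  have F_cis: "F (cis \<theta>) = - 2 * (sin ((\<theta> - \<alpha>) / 2) * sin ((\<theta> - \<beta>) / 2))" for \<theta>
  proof -
    have "F (cis \<theta>) = cos (\<theta> - m) - cos ((\<beta> - \<alpha>) / 2)"
      by (simp add: F_def cis_mult)
    also have "\<dots> = 2 * sin ((\<theta> - m + (\<beta> - \<alpha>) / 2) / 2) * sin (((\<beta> - \<alpha>) / 2 - (\<theta> - m)) / 2)"
      by (rule cos_diff_cos)
    also have "(\<theta> - m + (\<beta> - \<alpha>) / 2) / 2 = (\<theta> - \<alpha>) / 2" by (simp add: m_def field_simps)
    also have "((\<beta> - \<alpha>) / 2 - (\<theta> - m)) / 2 = - ((\<theta> - \<beta>) / 2)" by (simp add: m_def field_simps)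
    finally show ?thesis by simp
  qed
  obtain t :: real where t: "c = cis \<gamma> + of_real t * (cis \<delta> - cis \<gamma>)"
  proof -
    have "c \<in> chord_line (cis \<gamma>, cis \<delta>)"
      using assms(4) gd by (simp add: chord_line_unimodular)
    then obtain x y where xy: "c = x *\<^sub>R cis \<gamma> + y *\<^sub>R cis \<delta>" "x + y = 1"
      unfolding chord_line_def affine_hull_2 by auto
    then have "x = 1 - y" by simp
    from xy(1)[unfolded this] show ?thesis
      using that[of y] by (simp add: scaleR_conv_of_real algebra_simps)
  qed
  have "F c = (1 - t) * F (cis \<gamma>) + t * F (cis \<delta>)"
    unfolding F_def t by (simp add: algebra_simps)
  moreover have "F c = 0"
  proof -
    have "(c + cis \<alpha> * cis \<beta> * cnj c) * cis (- m) = (cis \<alpha> + cis \<beta>) * cis (- m)" using ab by simp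
    moreover have half: "- ((\<beta> - \<alpha>) / 2) = (\<alpha> - \<beta>) / 2" by (simp add: field_simps)
    have "cis \<alpha> * cis \<beta> * cis (- m) = cnj (cis (- m))" "cis \<alpha> * cis (- m) = cis (- ((\<beta> - \<alpha>) / 2))"
      "cis \<beta> * cis (- m) = cis ((\<beta> - \<alpha>) / 2)"
      unfolding half by (simp_all add: m_def cis_mult cis_cnj field_simps)
    ultimately have "c * cis (- m) + cnj (c * cis (- m)) = cis (- ((\<beta> - \<alpha>) / 2)) + cis ((\<beta> - \<alpha>) / 2)"
      unfolding complex_cnj_mult by algebra
    from arg_cong[OF this, of Re] show ?thesis by (simp add: F_def)
  qed
  moreover have "0 < t * (1 - t)"
  proof -
    have "(cmod c)\<^sup>2 = 1 - t * (1 - t) * (cmod (cis \<delta> - cis \<gamma>))\<^sup>2"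
    proof -
      have "complex_of_real ((cmod c)\<^sup>2) = c * cnj c" by (simp only: complex_norm_square)
      also have "\<dots> = 1 - of_real (t * (1 - t)) * ((cis \<delta> - cis \<gamma>) * cnj (cis \<delta> - cis \<gamma>))"
      proof -
        have 1: "cis \<gamma> * cnj (cis \<gamma>) = 1" "cis \<delta> * cnj (cis \<delta>) = 1"
          using unimodular_mult_cnj norm_cis by blast+
        have c': "cnj c = cnj (cis \<gamma>) + of_real t * (cnj (cis \<delta>) - cnj (cis \<gamma>))" by (simp add: t)
        show ?thesis unfolding c' complex_cnj_diff of_real_mult of_real_diff of_real_1
          unfolding t using 1 by algebra
      qed
      also have "\<dots> = of_real (1 - t * (1 - t) * (cmod (cis \<delta> - cis \<gamma>))\<^sup>2)"
        unfolding of_real_diff of_real_mult complex_norm_square by simp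
      finally show ?thesis unfolding of_real_eq_iff .
    qed
    moreover have "(cmod c)\<^sup>2 < 1" using c by (simp add: abs_square_less_1)
    ultimately have "0 < t * (1 - t) * (cmod (cis \<delta> - cis \<gamma>))\<^sup>2" by linarith
    then show ?thesis by (simp add: zero_less_mult_iff)
  qed
  then have "0 < t" "0 < 1 - t" by (auto simp: zero_less_mult_iff)
  moreover have "F (cis \<gamma>) < 0" "F (cis \<delta>) < 0" using side by (simp_all add: F_cis)
  ultimately have "F c < 0" by (metis add_neg_neg mult_pos_neg)
  then show False using \<open>F c = 0\<close> by simp
qed

lemma lessThan_4: "{..<4::nat} = {0, 1, 2, 3}"
  by auto

text \<open>The partners match the four points in two pairs. Neighbours cannot be matched, since then the two
  chords would not cross.\<close>

lemma partner_of_labelled_point: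
  assumes a: "cmod a < 1"
    and label: "cyclic_labelling 4 P Z"
    and invariant: "\<And>z. z \<in> Z \<Longrightarrow> chord_partner a z \<in> Z"
    and j: "j < 4"
  shows "cmod (P j) = 1 \<and> P ((j + 2) mod 4) = chord_partner a (P j)"
proof -
  obtain \<theta> where Z: "Z = P ` {..<4}" and mono: "strict_mono_on {..<4} \<theta>"
    and P: "\<And>j. j < 4 \<Longrightarrow> P j = cis (\<theta> j)" "\<And>j. j < 4 \<Longrightarrow> \<theta> j < \<theta> 0 + 2 * pi"
    using label unfolding cyclic_labelling_def by blast
  have \<theta>: "\<theta> 0 < \<theta> 1" "\<theta> 1 < \<theta> 2" "\<theta> 2 < \<theta> 3" "\<theta> 3 < \<theta> 0 + 2 * pi"
    using strict_mono_onD[OF mono] P(2) by auto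
  have unit: "cmod (P k) = 1" if "k < 4" for k using P(1)[OF that] by simp
  have inj: "P k \<noteq> P l" if "k < l" "l < 4" for k l
  proof
    assume "P k = P l"
    then have "cis (\<theta> k - \<theta> l) = 1" using P(1) that by (simp flip: cis_divide)
    then obtain n :: int where "Im (\<i> * complex_of_real (\<theta> k - \<theta> l)) = of_int (2 * n) * pi"
      unfolding cis_conv_exp exp_eq_1 by blast
    then have n: "\<theta> k - \<theta> l = of_int n * (2 * pi)" by simp
    have "\<theta> 0 \<le> \<theta> k" using strict_mono_onD[OF mono, of 0 k] that by (cases "k = 0") auto
    then have "- (2 * pi) < \<theta> k - \<theta> l" "\<theta> k - \<theta> l < 0"
      using strict_mono_onD[OF mono, of k l] P(2)[of l] that by auto
    then have "(- 1) * (2 * pi) < of_int n * (2 * pi)" "of_int n * (2 * pi) < 0 * (2 * pi)" unfolding n by simp_all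
    moreover have "x < y" if "x * (2 * pi) < y * (2 * pi)" for x y :: real
      using that mult_less_cancel_right_pos[of "2 * pi" x y] by simp
    ultimately have "- 1 < real_of_int n" "real_of_int n < 0" by blast+
    then have "- 1 < n" "n < 0" by simp_all
    then show False by simp
  qed
  let ?s = "chord_partner a"
  have in_Z: "?s (P k) \<in> {P 0, P 1, P 2, P 3}" if "k < 4" for k
  proof -
    have "P k \<in> Z" using that unfolding Z by blast
    then have "?s (P k) \<in> P ` {0, 1, 2, 3}" using invariant Z lessThan_4 by metis
    then show ?thesis by auto
  qed
  note s = partner_partner[OF a unit] partner_neq[OF a unit]
  have chord: "cnj a + cis \<alpha> * cis \<beta> * cnj (cnj a) = cis \<alpha> + cis \<beta>" if "?s (cis \<alpha>) = cis \<beta>" for \<alpha> \<beta>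
    using partner_sum[OF a norm_cis[of \<alpha>]] that by (simp add: algebra_simps)
  have pos: "0 < sin ((x - y) / 2)" "sin ((y - x) / 2) < 0" if "y < x" "x < y + 2 * pi" for x y
  proof -
    show "0 < sin ((x - y) / 2)" using that by (intro sin_gt_zero) auto
    then show "sin ((y - x) / 2) < 0" using sin_minus[of "(x - y) / 2"] by (simp add: minus_divide_left)
  qed
  have no: False if "?s (P 0) = P 1" "?s (P 2) = P 3"
  proof (rule chords_through_point_cross[of "cnj a" "\<theta> 2" "\<theta> 3" "\<theta> 0" "\<theta> 1"])
    show "cis (\<theta> 2) \<noteq> cis (\<theta> 3)" using inj[of 2 3] P(1) by simp
    show "0 < sin ((\<theta> 2 - \<theta> 0) / 2) * sin ((\<theta> 2 - \<theta> 1) / 2)"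
      "0 < sin ((\<theta> 3 - \<theta> 0) / 2) * sin ((\<theta> 3 - \<theta> 1) / 2)"
      using \<theta> by (auto intro!: mult_pos_pos pos)
  qed (use a that P(1) chord in auto)
  have no': False if "?s (P 1) = P 2" "?s (P 0) = P 3"
  proof (rule chords_through_point_cross[of "cnj a" "\<theta> 0" "\<theta> 3" "\<theta> 1" "\<theta> 2"])
    show "cis (\<theta> 0) \<noteq> cis (\<theta> 3)" using inj[of 0 3] P(1) by simp
    show "0 < sin ((\<theta> 0 - \<theta> 1) / 2) * sin ((\<theta> 0 - \<theta> 2) / 2)"
      using \<theta> by (auto intro!: mult_neg_neg pos)
    show "0 < sin ((\<theta> 3 - \<theta> 1) / 2) * sin ((\<theta> 3 - \<theta> 2) / 2)"
      using \<theta> by (auto intro!: mult_pos_pos pos)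
  qed (use a that P(1) chord in auto)
  have d: "P 0 \<noteq> P 1" "P 0 \<noteq> P 2" "P 0 \<noteq> P 3" "P 1 \<noteq> P 2" "P 1 \<noteq> P 3" "P 2 \<noteq> P 3"
    using inj by simp_all
  have s0: "?s (P 0) = P 2"
  proof (rule ccontr)
    assume "?s (P 0) \<noteq> P 2"
    then consider "?s (P 0) = P 1" | "?s (P 0) = P 3" using in_Z[of 0] s(2)[of 0] by auto
    then show False
    proof cases
      case 1
      then have "?s (P 1) = P 0" using s(1)[of 0] by simp
      then have "?s (P 2) = P 3" using 1 in_Z[of 2] s(1)[of 2] s(2)[of 2] d by auto
      then show False using no 1 by blast
    next
      case 2
      then have "?s (P 3) = P 0" using s(1)[of 0] by simp
      then have "?s (P 1) = P 2" using 2 in_Z[of 1] s(1)[of 1] s(2)[of 1] d by auto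
      then show False using no' 2 by blast
    qed
  qed
  then have s2: "?s (P 2) = P 0" using s(1)[of 0] by simp
  have s1: "?s (P 1) = P 3" using s0 s2 in_Z[of 1] s(1)[of 1] s(2)[of 1] d by auto
  then have s3: "?s (P 3) = P 1" using s(1)[of 1] by simp
  have step: "(0 + 2) mod 4 = (2::nat)" "(1 + 2) mod 4 = (3::nat)" "(2 + 2) mod 4 = (0::nat)"
    "(3 + 2) mod 4 = (1::nat)" by simp_all
  have "j = 0 \<or> j = 1 \<or> j = 2 \<or> j = 3" using j by auto
  then have "P ((j + 2) mod 4) = ?s (P j)"
    by (elim disjE) (simp_all only: step s0 s1 s2 s3)
  then show ?thesis using unit[OF j] by blast
qed

text \<open>Order the points by their arguments in \<open>(-\<pi>, \<pi>]\<close>.\<close>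

lemma cyclic_labelling_exists:
  assumes "finite S" "\<And>z. z \<in> S \<Longrightarrow> cmod z = 1"
  shows "\<exists>P. cyclic_labelling (card S) P S"
proof -
  define xs where "xs = sorted_list_of_set (Arg ` S)"
  have cis: "cis (Arg z) = z" if "z \<in> S" for z
  proof -
    have "z \<noteq> 0" using assms(2)[OF that] by auto
    then show ?thesis using assms(2)[OF that] by (simp add: cis_Arg sgn_eq)
  qed
  then have "inj_on Arg S" by (metis inj_onI)
  then have len: "length xs = card S" using card_image by (auto simp: xs_def)
  have set: "set xs = Arg ` S" using assms(1) by (simp add: xs_def)
  have sorted: "sorted_wrt (<) xs" by (simp add: xs_def)
  have bound: "- pi < xs ! j \<and> xs ! j \<le> pi" if "j < card S" for j
  proof -
    have "xs ! j \<in> Arg ` S" using that len set nth_mem by metis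
    then show ?thesis using Arg_bounded by auto
  qed
  have "cyclic_labelling (card S) (\<lambda>j. cis (xs ! j)) S"
    unfolding cyclic_labelling_def
  proof (intro conjI exI[of _ "\<lambda>j. xs ! j"])
    have "(\<lambda>j. cis (xs ! j)) ` {..<card S} = cis ` set xs"
      by (auto simp: set_conv_nth len)
    also have "\<dots> = S" unfolding set using cis by force
    finally show "S = (\<lambda>j. cis (xs ! j)) ` {..<card S}" by simp
    show "strict_mono_on {..<card S} (\<lambda>j. xs ! j)"
      using sorted len by (auto simp: strict_mono_on_def sorted_wrt_iff_nth_less)
    show "\<forall>j<card S. cis (xs ! j) = cis (xs ! j) \<and> xs ! j < xs ! 0 + 2 * pi"
    proof (intro allI impI conjI refl)
      fix j assume "j < card S"
      then show "xs ! j < xs ! 0 + 2 * pi" using bound[of j] bound[of 0] by force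
    qed
  qed
  then show ?thesis by blast
qed

section \<open>Pentagram chords\<close>

lemma szego_poly_1: "szego_poly [a] = [:- cnj a, 1:]"
  by (simp add: szego_poly_def szego_step_def rev_poly_def)

lemma szego_poly_2: "szego_poly [a, b] = [:- cnj b, a * cnj b - cnj a, 1:]"
proof -
  have "szego_poly [a, b] = szego_step (szego_poly [a]) b" by (simp add: szego_poly_def)
  moreover have "rev_poly [:- cnj a, 1:] = [:1, - a:]"
    by (cases "a = 0") (simp_all add: rev_poly_def reflect_poly_def map_poly_pCons cCons_def)
  ultimately show ?thesis by (simp add: szego_poly_1 szego_step_def)
qed

lemma rev_poly_monic_cubic: "rev_poly [:p, q, r, 1:] = [:1, cnj r, cnj q, cnj p:]"
  by (simp add: rev_poly_def reflect_poly_def map_poly_pCons cCons_def)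

text \<open>With \<open>N = z (z - cnj a)\<close> and \<open>M = 1 - a z\<close>, both \<open>z \<Phi>\<^sub>3 = N (N - cnj b M)\<close> and
  \<open>\<Phi>\<^sub>3* = M (M - b N)\<close> are forms in \<open>N\<close> and \<open>M\<close>.\<close>

lemma poly_szego_step_product:
  "poly (szego_step (szego_poly [a] * szego_poly [a, b]) l) z =
    (z * (z - cnj a))\<^sup>2 - (cnj b - cnj l * b) * (z * (z - cnj a)) * (1 - a * z) - cnj l * (1 - a * z)\<^sup>2"
proof -
  have "szego_poly [a] * szego_poly [a, b] =
      [:cnj a * cnj b, (cnj a)\<^sup>2 - a * cnj a * cnj b - cnj b, a * cnj b - 2 * cnj a, 1:]"
    by (simp add: szego_poly_1 szego_poly_2 power2_eq_square algebra_simps)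
  then show ?thesis
    by (simp add: szego_step_def rev_poly_monic_cubic power2_eq_square algebra_simps)
qed

lemma szego_zeros_invariant:
  assumes a: "cmod a < 1" and z: "cmod z = 1"
  shows "poly (szego_step (szego_poly [a] * szego_poly [a, b]) l) z = 0 \<longleftrightarrow>
    (z * chord_partner a z)\<^sup>2 + (cnj b - cnj l * b) * (z * chord_partner a z) - cnj l = 0"
proof -
  define m where "m = z * chord_partner a z"
  have "z * (z - cnj a) = - (m * (1 - a * z))"
    using partner_quadratic[OF a z, of z] by (simp add: m_def add_eq_0_iff2)
  then have "poly (szego_step (szego_poly [a] * szego_poly [a, b]) l) z =
      (m\<^sup>2 + (cnj b - cnj l * b) * m - cnj l) * (1 - a * z)\<^sup>2"
    unfolding poly_szego_step_product by algebra
  then show ?thesis using one_minus_nonzero[OF a z] by (simp add: m_def)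
qed

text \<open>The values of the Blaschke product \<open>N / M\<close> at the zeros are the roots \<open>\<mu>\<close>, \<open>\<nu>\<close> of a quadratic with sum
  \<open>cnj b - cnj l * b\<close> and product \<open>- cnj l\<close>. So \<open>\<mu> + \<nu> = cnj b + b \<mu> \<nu>\<close>, that is, \<open>\<nu>\<close> is the
  partner of \<open>\<mu>\<close> with respect to \<open>b\<close>; this determines \<open>l\<close> from \<open>z\<close> and shows \<open>\<mu> \<noteq> \<nu>\<close>.\<close>

lemma szego_zeros_through:
  assumes a: "cmod a < 1" and b: "cmod b < 1" and z: "cmod z = 1"
  shows "\<exists>l w. cmod l = 1 \<and> cmod w = 1 \<and>
    {x. poly (szego_step (szego_poly [a] * szego_poly [a, b]) l) x = 0} =
      {z, chord_partner a z, w, chord_partner a w} \<and>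
    card {z, chord_partner a z, w, chord_partner a w} = 4"
proof -
  define \<mu> where "\<mu> = - (z * chord_partner a z)"
  have \<mu>: "cmod \<mu> = 1" using z norm_partner[OF a z] by (simp add: \<mu>_def norm_mult)
  define \<nu> where "\<nu> = chord_partner b \<mu>"
  have \<nu>: "cmod \<nu> = 1" "\<nu> \<noteq> \<mu>" "\<mu> + \<nu> = cnj b + b * (\<mu> * \<nu>)"
    unfolding \<nu>_def using norm_partner[OF b \<mu>] partner_neq[OF b \<mu>] partner_sum[OF b \<mu>] by auto
  obtain w where w: "cmod w = 1" "w * chord_partner a w = - \<nu>"
    using partner_product_surj[OF a, of "- \<nu>"] \<nu>(1) by auto
  define l where "l = - cnj (\<mu> * \<nu>)"
  have l: "cmod l = 1" using \<mu> \<nu>(1) by (simp add: l_def norm_mult)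
  have l': "cnj l = - (\<mu> * \<nu>)" by (simp add: l_def)
  have "poly (szego_step (szego_poly [a] * szego_poly [a, b]) l) x =
      (x * (x - cnj a) + z * chord_partner a z * (1 - a * x)) * (x * (x - cnj a) + w * chord_partner a w * (1 - a * x))" for x
  proof -
    have "z * chord_partner a z = - \<mu>" by (simp add: \<mu>_def)
    then show ?thesis
      unfolding poly_szego_step_product l' w(2) using \<nu>(3) by algebra
  qed
  then have "{x. poly (szego_step (szego_poly [a] * szego_poly [a, b]) l) x = 0} =
      {z, chord_partner a z, w, chord_partner a w}"
    unfolding partner_quadratic[OF a z] partner_quadratic[OF a w(1)] by auto
  moreover have "card {z, chord_partner a z, w, chord_partner a w} = 4"
  proof -
    have "w * chord_partner a w \<noteq> z * chord_partner a z"
      using w(2) \<nu>(2) unfolding \<mu>_def by (metis minus_minus)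
    then have "w \<noteq> z" "w \<noteq> chord_partner a z" "chord_partner a w \<noteq> z"
      "chord_partner a w \<noteq> chord_partner a z"
      using partner_partner[OF a z] partner_partner[OF a w(1)] by (metis mult.commute)+
    then show ?thesis using partner_neq[OF a z] partner_neq[OF a w(1)] by (simp add: eq_commute)
  qed
  ultimately show ?thesis using l w(1) by blast
qed

lemma pentagram_chords_of_szego_product:
  fixes A :: "complex^3^3"
  assumes a: "cmod a < 1" and b: "cmod b < 1" and char: "charpoly A = szego_poly [a] * szego_poly [a, b]"
  shows "pentagram_chords A = {(z, chord_partner a z) | z. cmod z = 1}"
proof -
  define Z where "Z l = {z. poly (szego_step (charpoly A) l) z = 0}" for l
  have chords: "pentagram_chords A =
      {(P j, P ((j + 2) mod 4)) | P j l. cmod l = 1 \<and> j < 4 \<and> cyclic_labelling 4 P (Z l)}"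
    by (simp add: pentagram_chords_def Z_def)
  have partner: "cmod (P j) = 1 \<and> P ((j + 2) mod 4) = chord_partner a (P j)"
    if "cyclic_labelling 4 P (Z l)" "j < 4" for P j l
  proof (rule partner_of_labelled_point[OF a that(1) _ that(2)])
    fix z assume z: "z \<in> Z l"
    have "cmod z = 1" using that(1) z unfolding cyclic_labelling_def by auto
    then show "chord_partner a z \<in> Z l"
      using z unfolding Z_def char
      by (simp add: szego_zeros_invariant[OF a] norm_partner[OF a] partner_partner[OF a] mult.commute)
  qed
  show ?thesis
  proof
    show "pentagram_chords A \<subseteq> {(z, chord_partner a z) | z. cmod z = 1}"
      unfolding chords using partner by blast
    show "{(z, chord_partner a z) | z. cmod z = 1} \<subseteq> pentagram_chords A"
    proof
      fix c assume "c \<in> {(z, chord_partner a z) | z. cmod z = 1}"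
      then obtain z where z: "cmod z = 1" "c = (z, chord_partner a z)" by blast
      obtain l w where l: "cmod l = 1" and w: "cmod w = 1"
        and Z: "Z l = {z, chord_partner a z, w, chord_partner a w}" "card (Z l) = 4"
        using szego_zeros_through[OF a b z(1)] unfolding Z_def char by metis
      have "finite (Z l)" "\<And>x. x \<in> Z l \<Longrightarrow> cmod x = 1"
        unfolding Z(1) using z(1) w norm_partner[OF a] by auto
      then obtain P where P: "cyclic_labelling 4 P (Z l)"
        using cyclic_labelling_exists[of "Z l"] Z(2) by auto
      then have "Z l = P ` {..<4}" by (simp add: cyclic_labelling_def)
      then obtain j where j: "j < 4" "z = P j"
        using Z(1) by (metis imageE insertI1 lessThan_iff)
      then have "c = (P j, P ((j + 2) mod 4))" using partner[OF P j(1)] z(2) by simp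
      then show "c \<in> pentagram_chords A" unfolding chords using l j(1) P by blast
    qed
  qed
qed

lemma center_in_chord_line:
  assumes "cmod a < 1" "cmod z = 1"
  shows "cnj a \<in> chord_line (z, chord_partner a z)"
  unfolding chord_line_partner[OF assms] by simp

text \<open>Distinct lines of the pencil meet only in its centre. That the centre is a limit of such intersections needs
  one line approached by others.\<close>

lemma envelope_of_pencil:
  assumes a: "cmod a < 1"
  shows "envelope {(z, chord_partner a z) | z. cmod z = 1} = {cnj a}" (is "envelope ?C = _")
proof -
  have common: "q = cnj a" if c: "c \<in> ?C" "d \<in> ?C" "chord_line d \<noteq> chord_line c"
    "q \<in> chord_line d \<inter> chord_line c" for c d q
  proof (rule ccontr)
    assume q: "q \<noteq> cnj a"
    obtain z w where zw: "cmod z = 1" "c = (z, chord_partner a z)" "cmod w = 1" "d = (w, chord_partner a w)"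
      using c(1,2) by blast
    have "cnj (q - cnj a) \<noteq> 0" using q by (metis complex_cnj_zero_iff eq_iff_diff_eq_0)
    moreover have "q - cnj a = - (z * chord_partner a z) * cnj (q - cnj a)"
      "q - cnj a = - (w * chord_partner a w) * cnj (q - cnj a)"
      using c(4) chord_line_partner[OF a zw(1), of q] chord_line_partner[OF a zw(3), of q]
      unfolding zw(2,4) by blast+
    ultimately have "z * chord_partner a z = w * chord_partner a w"
      by (metis minus_equation_iff mult_right_cancel)
    then have "chord_line d = chord_line c"
      unfolding zw(2,4) set_eq_iff chord_line_partner[OF a zw(1)] chord_line_partner[OF a zw(3)]
      by simp
    then show False using c(3) by blast
  qed
  show ?thesis
  proof
    show "envelope ?C \<subseteq> {cnj a}"
    proof
      fix p assume "p \<in> envelope ?C"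
      then obtain c X q where c: "c \<in> ?C" and X: "\<And>k::nat. X k \<in> ?C \<and> chord_line (X k) \<noteq> chord_line c \<and>
          q k \<in> chord_line (X k) \<inter> chord_line c" and q: "q \<longlonglongrightarrow> p"
        unfolding envelope_def by blast
      have "q k = cnj a" for k using common[OF c] X[of k] by blast
      then have "q = (\<lambda>k. cnj a)" by auto
      then have "p = cnj a" using q LIMSEQ_unique[OF q, of "cnj a"] by auto
      then show "p \<in> {cnj a}" by simp
    qed
    \<comment> \<open>The diameter through \<open>cnj a\<close> serves as the approached line: its ends are \<open>z0\<close> and \<open>- z0\<close>, and no \<open>zk k\<close> below is either of them.\<close>
    obtain z0 where z0: "cmod z0 = 1" "a * z0\<^sup>2 = cnj a"
    proof (cases "a = 0")
      case True
      then show ?thesis using that[of 1] by simp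
    next
      case False
      have "(cmod (csqrt (cnj a / a)))\<^sup>2 = 1"
        using False by (simp add: norm_divide flip: norm_power)
      then show ?thesis
        using that[of "csqrt (cnj a / a)"] False norm_ge_zero[of "csqrt (cnj a / a)"]
        by (auto simp: power2_eq_1_iff)
    qed
    have partner0: "chord_partner a z0 = - z0"
      using partner_unique[OF a z0(1), of "- z0"] z0(2) by (simp add: power2_eq_square)
    define zk where "zk k = z0 * cis (inverse (real (Suc k)))" for k
    have zk: "cmod (zk k) = 1" for k using z0(1) by (simp add: zk_def norm_mult)
    define X where "X k = (zk k, chord_partner a (zk k))" for k
    define c where "c = (z0, chord_partner a z0)"
    have lines: "chord_line (X k) \<noteq> chord_line c" for k
    proof
      assume "chord_line (X k) = chord_line c"
      moreover have "z0 \<in> chord_line c" by (simp add: c_def chord_line_def hull_inc)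
      ultimately have "z0 \<in> chord_line (zk k, chord_partner a (zk k))"
        "z0 \<in> chord_line (z0, chord_partner a z0)"
        unfolding X_def c_def by blast+
      then have "z0 - cnj a = - (zk k * chord_partner a (zk k)) * cnj (z0 - cnj a)"
        "z0 - cnj a = - (z0 * chord_partner a z0) * cnj (z0 - cnj a)"
        unfolding chord_line_partner[OF a zk] chord_line_partner[OF a z0(1)] .
      moreover have "cnj (z0 - cnj a) \<noteq> 0" 
        using z0(1) a by (metis complex_cnj_zero_iff complex_mod_cnj eq_iff_diff_eq_0 less_irrefl)
      ultimately have "z0 * chord_partner a z0 = zk k * chord_partner a (zk k)"
        by (metis minus_equation_iff mult_right_cancel)
      then have "zk k = z0 \<or> zk k = - z0"
        using partner_product_eq[OF a z0(1) zk] partner0 by metis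
      moreover have "z0 \<noteq> 0" using z0(1) by auto
      ultimately have "cis (inverse (real (Suc k))) = 1 \<or> cis (inverse (real (Suc k))) = - 1"
        unfolding zk_def by (metis mult.right_neutral mult_cancel_left mult_minus_right)
      then have "sin (inverse (real (Suc k))) = 0" by (auto simp: complex_eq_iff)
      moreover have "0 < sin (inverse (real (Suc k)))"
      proof (rule sin_gt_zero)
        have "inverse (real (Suc k)) \<le> 1" by (simp add: inverse_le_1_iff)
        then show "inverse (real (Suc k)) < pi" using pi_gt3 by linarith
      qed simp
      ultimately show False by simp
    qed
    have "(\<lambda>k. cis (inverse (real (Suc k)))) \<longlonglongrightarrow> cis 0"
      by (intro tendsto_cis LIMSEQ_inverse_real_of_nat)
    then have lim: "zk \<longlonglongrightarrow> z0" unfolding zk_def using tendsto_mult_left[of _ 1 sequentially z0] by simp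
    then have "X \<longlonglongrightarrow> c"
      unfolding X_def c_def chord_partner_def
      using one_minus_nonzero[OF a z0(1)] by (intro tendsto_intros lim) auto
    moreover have "c \<in> ?C" "\<And>k. X k \<in> ?C" using z0(1) zk unfolding c_def X_def by blast+
    moreover have "cnj a \<in> chord_line (X k) \<inter> chord_line c" for k
      unfolding X_def c_def using center_in_chord_line[OF a] zk z0(1) by blast
    ultimately have "cnj a \<in> envelope ?C"
      unfolding envelope_def using lines
      by (intro CollectI bexI[of _ c] exI[of _ X] exI[of _ "\<lambda>k. cnj a"]) auto
    then show "{cnj a} \<subseteq> envelope ?C" by simp
  qed
qed

section \<open>Elliptical numerical ranges and the pentagram curve\<close>

theorem theorem4:
  fixes A :: "complex^3^3"
  assumes "A \<in> S_class"
  shows "(elliptical_disk (numerical_range A) \<longleftrightarrow>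
           (\<exists>a b. a \<in> ball 0 1 \<and> b \<in> ball 0 1 \<and>
              charpoly A = szego_poly [a] * szego_poly [a, b])) \<and>
         (\<forall>a b. a \<in> ball 0 1 \<and> b \<in> ball 0 1 \<and>
              charpoly A = szego_poly [a] * szego_poly [a, b] \<longrightarrow>
            pentagram_curve A = {cnj a} \<and>
            (\<forall>c\<in>pentagram_chords A. cnj a \<in> chord_line c) \<and>
            (\<exists>f g. ellipse_with_foci (frontier (numerical_range A)) f g \<and>
               szego_poly [a, b] = [:- f, 1:] * [:- g, 1:]))"
proof -
  have split: "szego_poly [a, b] = [:- f, 1:] * [:- g, 1:] \<longleftrightarrow>
      f + g = cnj a - a * cnj b \<and> f * g = - cnj b" for a b f g
    unfolding szego_poly_2 by (auto simp: algebra_simps minus_equation_iff)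
  have rank: "rank (mat 1 - A ** cadjoint A) = 1" using assms by (simp add: S_class_def)
  have consequences: "pentagram_curve A = {cnj a}" "\<forall>c\<in>pentagram_chords A. cnj a \<in> chord_line c"
    "\<exists>f g. ellipse_with_foci (frontier (numerical_range A)) f g \<and>
      szego_poly [a, b] = [:- f, 1:] * [:- g, 1:]"
    if ab: "a \<in> ball 0 1" "b \<in> ball 0 1" and char: "charpoly A = szego_poly [a] * szego_poly [a, b]" for a b
  proof -
    have a: "cmod a < 1" and b: "cmod b < 1" using ab by simp_all
    note chords = pentagram_chords_of_szego_product[OF a b char]
    show "pentagram_curve A = {cnj a}"
      unfolding pentagram_curve_def chords by (rule envelope_of_pencil[OF a])
    show "\<forall>c\<in>pentagram_chords A. cnj a \<in> chord_line c"
      unfolding chords using center_in_chord_line[OF a] by blast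
    obtain f g where fg: "f + g = cnj a - a * cnj b" "f * g = - cnj b"
      using complex_quadratic_roots by blast
    then have eq: "szego_poly [a, b] = [:- f, 1:] * [:- g, 1:]" unfolding split by blast
    have "ellipse_with_foci (frontier (numerical_range A)) f g"
      using numerical_range_of_szego_product[OF rank a b fg] char unfolding szego_poly_1 eq by blast
    then show "\<exists>f g. ellipse_with_foci (frontier (numerical_range A)) f g \<and>
      szego_poly [a, b] = [:- f, 1:] * [:- g, 1:]" using eq by blast
  qed
  have factorisation: "\<exists>a b. a \<in> ball 0 1 \<and> b \<in> ball 0 1 \<and> charpoly A = szego_poly [a] * szego_poly [a, b]"
    if W: "elliptical_disk (numerical_range A)"
  proof -
    obtain f g where "ellipse_with_foci (frontier (numerical_range A)) f g"
      using W unfolding elliptical_disk_def by blast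
    then obtain a b where ab: "cmod a < 1" "cmod b < 1"
      and fg: "f + g = cnj a - a * cnj b" "f * g = - cnj b"
      and char: "charpoly A = [:- cnj a, 1:] * ([:- f, 1:] * [:- g, 1:])"
      using charpoly_of_elliptical_numerical_range[OF assms] by blast
    have "charpoly A = szego_poly [a] * szego_poly [a, b]"
      using fg char split szego_poly_1 by metis
    then show ?thesis using ab by (metis mem_ball_0)
  qed
  show ?thesis
  proof (intro conjI iffI allI impI)
    assume "\<exists>a b. a \<in> ball 0 1 \<and> b \<in> ball 0 1 \<and> charpoly A = szego_poly [a] * szego_poly [a, b]"
    then show "elliptical_disk (numerical_range A)"
      using consequences(3) unfolding elliptical_disk_def by meson
  qed (use factorisation consequences in \<open>blast+\<close>)
qed

end
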